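(* Let $v\in\mathfrak{S}_n$ be a boolean permutation and let $s$ be an optimal run word for $v$, written as a concatenation $s=r_1\cdots r_m$ of $m=\textsf{run}(v)$ runs. For each $i$, define a word $t_i$ as follows: if $r_i=a(a+1)\cdots(a+b)$ with $b>0$, let $t_i=(a+1)(a+2)\cdots(a+b)\,a\,(a+1)\cdots(a+b-1)$; if $r_i=(a+b)\cdots(a+1)a$ with $b>0$, let $t_i=(a+b-1)\cdots(a+1)a\,(a+b)\cdots(a+2)(a+1)$; if $r_i$ has a single letter, let $t_i$ be the empty word. Let $w$ be the permutation with reduced word $t_1\cdots t_m$. Then $w$ is an optimal partner for $v$, and $\textsf{ork}(v)=\ell(v)-\textsf{run}(v)$.
   Context: Permutations are composed right to left; $\sigma_i=(i,i+1)$; a word $i_1\cdots i_k$ represents $\sigma_{i_1}\cdots\sigma_{i_k}$, and it is reduced if $k$ is minimal. $\ell$ is the length function; $B(w)$ is the principal order ideal of $w$ in the Bruhat order. A permutation is boolean if its reduced words have no repeated letters. A run is a sequence of consecutive integers, either increasing or decreasing (a single letter is a run). For boolean $v$, $\textsf{run}(v)$ is the fewest number of runs whose concatenation is a reduced word for $v$, and an optimal run word for $v$ is a reduced word for $v$ that is a concatenation of $\textsf{run}(v)$ runs. For a subset $Q\subseteq\mathfrak{S}_n$ with the induced Bruhat order, an almost perfect matching of $Q$ is a chain $\emptyset=Q_0\subset Q_1\subset\cdots\subset Q_l=Q$ of coideals (upward-closed subsets) of $Q$ such that each $Q_i\setminus Q_{i-1}$ is a pair $\{x_i,y_i\}$ with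 $x_i<y_i$ and $\ell(y_i)=\ell(x_i)+1$, except for exactly one index $i$ for which $Q_i\setminus Q_{i-1}$ is a singleton $\{z\}$ (the unmatched element). For boolean $v$, the optimal rank $\textsf{ork}(v)$ is the largest value of $\ell(z)$ over all $w\in\mathfrak{S}_n$ and all almost perfect matchings of $B(v)\cap B(w)$ with unmatched element $z$; an optimal partner of $v$ is a $w$ for which $B(v)\cap B(w)$ has an almost perfect matching whose unmatched element has length $\textsf{ork}(v)$. *)

theory Defs
  imports "HOL-Combinatorics.Permutations"
begin

(* Permutations of {1..n} are functions nat => nat with p permutes {1..n}.
   Composition is right to left (function composition).  The simple
   transposition sigma_i swaps i and i+1.  A word is a list of letters. *)

definition sigma :: "nat \<Rightarrow> nat \<Rightarrow> nat" where
  "sigma i = Transposition.transpose i (Suc i)"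

definition word_perm :: "nat list \<Rightarrow> nat \<Rightarrow> nat" where
  "word_perm w = foldr (\<lambda>i p. sigma i \<circ> p) w id"

definition is_word :: "nat \<Rightarrow> nat list \<Rightarrow> bool" where
  "is_word n w \<longleftrightarrow> set w \<subseteq> {1..<n}"

definition len :: "nat \<Rightarrow> (nat \<Rightarrow> nat) \<Rightarrow> nat" where
  "len n p = (LEAST k. \<exists>w. is_word n w \<and> length w = k \<and> word_perm w = p)"

definition reduced :: "nat \<Rightarrow> nat list \<Rightarrow> bool" where
  "reduced n w \<longleftrightarrow> is_word n w \<and> length w = len n (word_perm w)"

definition bruhat_step :: "nat \<Rightarrow> (nat \<Rightarrow> nat) \<Rightarrow> (nat \<Rightarrow> nat) \<Rightarrow> bool" where
  "bruhat_step n u x \<longleftrightarrow> u permutes {1..n} \<and>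
     (\<exists>i j. 1 \<le> i \<and> i < j \<and> j \<le> n \<and> x = u \<circ> Transposition.transpose i j \<and> len n u < len n x)"

definition bruhat_le :: "nat \<Rightarrow> (nat \<Rightarrow> nat) \<Rightarrow> (nat \<Rightarrow> nat) \<Rightarrow> bool" where
  "bruhat_le n u x \<longleftrightarrow> u permutes {1..n} \<and> (bruhat_step n)\<^sup>*\<^sup>* u x"

definition bruhat_lt :: "nat \<Rightarrow> (nat \<Rightarrow> nat) \<Rightarrow> (nat \<Rightarrow> nat) \<Rightarrow> bool" where
  "bruhat_lt n u x \<longleftrightarrow> bruhat_le n u x \<and> u \<noteq> x"

definition bideal :: "nat \<Rightarrow> (nat \<Rightarrow> nat) \<Rightarrow> (nat \<Rightarrow> nat) set" where
  "bideal n w = {u. bruhat_le n u w}"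

definition boolean_perm :: "nat \<Rightarrow> (nat \<Rightarrow> nat) \<Rightarrow> bool" where
  "boolean_perm n v \<longleftrightarrow> v permutes {1..n} \<and>
     (\<forall>w. reduced n w \<and> word_perm w = v \<longrightarrow> distinct w)"

definition is_run :: "nat list \<Rightarrow> bool" where
  "is_run r \<longleftrightarrow> r \<noteq> [] \<and>
     ((\<forall>i<length r. r ! i = hd r + i) \<or> (\<forall>i<length r. r ! i + i = hd r))"

definition run_num :: "nat \<Rightarrow> (nat \<Rightarrow> nat) \<Rightarrow> nat" where
  "run_num n v = (LEAST m. \<exists>rs. length rs = m \<and> (\<forall>r\<in>set rs. is_run r) \<and>
       reduced n (concat rs) \<and> word_perm (concat rs) = v)"

definition optimal_run_factorization :: "nat \<Rightarrow> (nat \<Rightarrow> nat) \<Rightarrow> nat list list \<Rightarrow> bool" where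
  "optimal_run_factorization n v rs \<longleftrightarrow> (\<forall>r\<in>set rs. is_run r) \<and>
     length rs = run_num n v \<and> reduced n (concat rs) \<and> word_perm (concat rs) = v"

definition coideal :: "nat \<Rightarrow> (nat \<Rightarrow> nat) set \<Rightarrow> (nat \<Rightarrow> nat) set \<Rightarrow> bool" where
  "coideal n Q C \<longleftrightarrow> C \<subseteq> Q \<and> (\<forall>x\<in>C. \<forall>y\<in>Q. bruhat_le n x y \<longrightarrow> y \<in> C)"

(* almost perfect matching of Q with unmatched element z, encoded by the list of
   differences Ds = [Q_1 - Q_0, ..., Q_l - Q_(l-1)] *)
definition apm :: "nat \<Rightarrow> (nat \<Rightarrow> nat) set \<Rightarrow> (nat \<Rightarrow> nat) \<Rightarrow> bool" where
  "apm n Q z \<longleftrightarrow> (\<exists>Ds :: (nat \<Rightarrow> nat) set list.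
     \<Union>(set Ds) = Q \<and>
     (\<forall>i<length Ds. \<forall>j<length Ds. i \<noteq> j \<longrightarrow> Ds ! i \<inter> Ds ! j = {}) \<and>
     (\<forall>k\<le>length Ds. coideal n Q (\<Union>(set (take k Ds)))) \<and>
     (\<exists>i<length Ds. Ds ! i = {z} \<and>
        (\<forall>j<length Ds. j \<noteq> i \<longrightarrow>
           (\<exists>x y. Ds ! j = {x, y} \<and> bruhat_lt n x y \<and> len n y = len n x + 1))))"

definition ork_set :: "nat \<Rightarrow> (nat \<Rightarrow> nat) \<Rightarrow> nat set" where
  "ork_set n v = {len n z | z. \<exists>w. w permutes {1..n} \<and> apm n (bideal n v \<inter> bideal n w) z}"

definition ork :: "nat \<Rightarrow> (nat \<Rightarrow> nat) \<Rightarrow> nat" where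
  "ork n v = Max (ork_set n v)"

definition optimal_partner :: "nat \<Rightarrow> (nat \<Rightarrow> nat) \<Rightarrow> (nat \<Rightarrow> nat) \<Rightarrow> bool" where
  "optimal_partner n v w \<longleftrightarrow> w permutes {1..n} \<and>
     (\<exists>z. apm n (bideal n v \<inter> bideal n w) z \<and> len n z = ork n v)"

definition run_t :: "nat list \<Rightarrow> nat list" where
  "run_t r = (if length r \<le> 1 then []
     else if r ! 1 = Suc (r ! 0) then
       (let a = hd r; b = length r - 1 in [a+1..<a+b+1] @ [a..<a+b])
     else
       (let a = last r; b = length r - 1 in rev [a..<a+b] @ rev [a+1..<a+b+1]))"

end

theory Submission
  imports Defs "HOL-Library.Sublist" "HOL-Library.Z2"
begin

text \<open>
  Let \<open>V\<close> be the set of letters of \<open>s\<close>. Sending \<open>F \<subseteq> V\<close> to the subword of \<open>s\<close> on the letters in \<open>F\<close>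
  identifies \<open>B(v)\<close> with the Boolean lattice on \<open>V\<close>, so that \<open>B(v) \<inter> B(w)\<close> becomes a simplicial complex
  on \<open>V\<close>, and an almost perfect matching collapses this complex with a single critical face \<open>z\<close>.
  Hence the complex has nonzero reduced homology over the field with two elements in the degree of \<open>z\<close>.
  Its minimal nonfaces are intervals of letters on which \<open>s\<close> is monotone, because occurrences in a
  reduced word of \<open>w\<close> can be glued at a gap or at a letter where the direction changes.
  As in the Taylor resolution, nonzero homology in the degree of \<open>z\<close> forces \<open>V\<close> to be covered by at
  most \<open>|V| - \<ell>(z)\<close> nonfaces, and a cover by \<open>j\<close> monotone intervals yields a factorization of \<open>v\<close>
  into at most \<open>j\<close> runs; so \<open>\<ell>(z) \<le> \<ell>(v) - run(v)\<close>. For the word \<open>t\<^sub>1 \<dots> t\<^sub>m\<close> the minimal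
  nonfaces are exactly the letter sets of the runs, the complex is a join of boundaries of simplices,
  and toggling one chosen letter per run is an almost perfect matching attaining the bound.
\<close>

section \<open>Words and the Bruhat order\<close>

text \<open>The upper bound ranges over every \<open>w\<close> and every matching, so it has to come
  from an invariant of the complex and not from a particular matching; homology is that invariant,
  because matched pairs cancel and only the critical face can carry a class. Monotone intervals link
  it to runs. At a gap or a change of direction two occurrences in a word can be merged, but inside
  a monotone stretch a letter must lie after one neighbour and before the other, and two occurrences
  may need different positions for it. The bound \<open>|V| - \<ell>(z)\<close> on the number of
  covering nonfaces arises because each nonface absorbed into the link raises the size of the faces
  by one. The word \<open>t_i\<close> consists of two shifted copies of the run, each one letter
  short and placed in the wrong order: once a letter is omitted, the two remaining pieces commute
  and fit one into each copy, while the whole run never fits.\<close>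

lemma word_perm_Nil [simp]: "word_perm [] = id"
  by (simp add: word_perm_def)

lemma word_perm_Cons [simp]: "word_perm (k # w) = sigma k \<circ> word_perm w"
  by (simp add: word_perm_def)

lemma word_perm_append [simp]: "word_perm (u @ w) = word_perm u \<circ> word_perm w"
  by (induction u) (auto simp: fun_eq_iff)

lemma sigma_apply: "sigma k x = (if x = k then Suc k else if x = Suc k then k else x)"
  by (simp add: sigma_def transpose_def)

lemma bij_word_perm: "bij (word_perm w)"
proof (induction w)
  case (Cons k w)
  then show ?case unfolding word_perm_Cons sigma_def by (intro bij_comp) simp_all
qed (simp only: word_perm_Nil bij_id)

lemma inj_word_perm: "inj (word_perm w)"
  using bij_word_perm by (rule bij_is_inj)

lemma word_perm_eq_iff [simp]: "word_perm w x = word_perm w y \<longleftrightarrow> x = y"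
  using inj_word_perm by (auto dest: injD)

lemma word_perm_surj: obtains x where "word_perm w x = y"
  by (metis bij_word_perm bij_pointE)

lemma is_word_simps [simp]:
  "is_word n []" "is_word n (k # w) \<longleftrightarrow> 1 \<le> k \<and> k < n \<and> is_word n w"
  "is_word n (u @ w) \<longleftrightarrow> is_word n u \<and> is_word n w"
  by (auto simp: is_word_def)

lemma subseq_set: "subseq u w \<Longrightarrow> set u \<subseteq> set w"
  by (auto elim: list_emb_set)

lemma is_word_subseq: "subseq u w \<Longrightarrow> is_word n w \<Longrightarrow> is_word n u"
  unfolding is_word_def using subseq_set by blast

lemma word_perm_permutes: "is_word n w \<Longrightarrow> word_perm w permutes {1..n}"
proof (induction w)
  case (Cons k w)
  then have "sigma k permutes {1..n}"
    unfolding sigma_def by (intro permutes_swap_id) auto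
  with Cons show ?case unfolding word_perm_Cons by (intro permutes_compose) simp_all
qed (simp add: permutes_id)

lemma transpose_word:
  assumes "1 \<le> i" "i < j" "j \<le> n"
  obtains w where "is_word n w" "word_perm w = Transposition.transpose i j"
  using assms
proof (induction "j - i" arbitrary: j thesis)
  case 0
  then show ?case by simp
next
  case (Suc d)
  show ?case
  proof (cases "j = Suc i")
    case True
    then show ?thesis using Suc.prems by (intro Suc.prems(1)[of "[i]"]) (auto simp: sigma_def)
  next
    case False
    have "d = (j - 1) - i" "i < j - 1" "j - 1 \<le> n" using Suc.hyps(2) Suc.prems False by auto
    with Suc.hyps(1)[of "j-1"] Suc.prems(2) obtain w where
      w: "is_word n w" "word_perm w = Transposition.transpose i (j - 1)" by blast
    \<comment> \<open>Conjugation by \<open>sigma (j - 1)\<close> moves the upper end of the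
      transposition from \<open>j - 1\<close> to \<open>j\<close>.\<close>
    have "word_perm ((j-1) # w @ [j-1]) = Transposition.transpose i j"
      using \<open>i < j - 1\<close> by (auto simp: w sigma_def fun_eq_iff transpose_def)
    moreover have "is_word n ((j-1) # w @ [j-1])" using w Suc.prems \<open>i < j - 1\<close> by simp
    ultimately show ?thesis using Suc.prems(1) by blast
  qed
qed

lemma permutes_word:
  assumes "p permutes {1..n}"
  obtains w where "is_word n w" "word_perm w = p"
proof -
  have "\<exists>w. is_word n w \<and> word_perm w = p"
    using assms finite_atLeastAtMost
  proof (induction rule: permutes_induct)
    case id
    then show ?case by (intro exI[of _ "[]"]) simp
  next
    case (swap a b p)
    then obtain w where w: "is_word n w" "word_perm w = p" by blast
    obtain w' where w': "is_word n w'" "word_perm w' = Transposition.transpose a b"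
    proof (cases "a < b")
      case True
      then show ?thesis using transpose_word[of a b n] swap that by auto
    next
      case False
      then show ?thesis using transpose_word[of b a n] swap that
        by (auto simp: transpose_commute)
    qed
    show ?case using w w' by (intro exI[of _ "w' @ w"]) simp
  qed
  with that show ?thesis by blast
qed

section \<open>Length and the strong exchange property\<close>

lemma len_le: "is_word n w \<Longrightarrow> len n (word_perm w) \<le> length w"
  unfolding len_def by (rule Least_le) auto

lemma reduced_word:
  assumes "p permutes {1..n}"
  obtains w where "reduced n w" "word_perm w = p"
proof -
  obtain w0 where "is_word n w0" "word_perm w0 = p" using permutes_word[OF assms] .
  then have "\<exists>k w. is_word n w \<and> length w = k \<and> word_perm w = p" by blast
  from LeastI_ex[OF this] obtain w where "is_word n w" "length w = len n p" "word_perm w = p"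
    unfolding len_def by blast
  then show ?thesis using that[of w] by (simp add: reduced_def)
qed

lemma sigma_comp_word_perm:
  assumes "word_perm w i = k" "word_perm w j = Suc k"
  shows "sigma k \<circ> word_perm w = word_perm w \<circ> Transposition.transpose i j"
proof
  fix x
  show "(sigma k \<circ> word_perm w) x = (word_perm w \<circ> Transposition.transpose i j) x"
    using assms word_perm_eq_iff[of w x i] word_perm_eq_iff[of w x j]
    by (auto simp: sigma_apply transpose_def)
qed

text \<open>Read from the right, the values at \<open>i\<close> and \<open>j\<close> begin in order,
  so some letter \<open>k\<close> turns them over. At that moment they are \<open>k\<close> and
  \<open>Suc k\<close>, hence deleting this letter exchanges exactly the two arguments.\<close>

lemma strong_exchange:
  assumes "i < j" "word_perm w i > word_perm w j"
  obtains u where "subseq u w" "Suc (length u) = length w"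
    "word_perm u = word_perm w \<circ> Transposition.transpose i j"
  using assms
proof (induction w arbitrary: thesis)
  case Nil
  then show ?case by simp
next
  case (Cons k w)
  show ?case
  proof (cases "word_perm w i > word_perm w j")
    case True
    then obtain u where "subseq u w" "Suc (length u) = length w"
      "word_perm u = word_perm w \<circ> Transposition.transpose i j" using Cons by blast
    then show ?thesis by (intro Cons.prems(1)[of "k # u"]) (auto simp: comp_assoc)
  next
    case False
    have "word_perm w i \<noteq> word_perm w j" using Cons.prems by simp
    then have "word_perm w i = k" "word_perm w j = Suc k"
      using False Cons.prems by (auto simp: sigma_apply split: if_splits)
    then have "sigma k \<circ> word_perm w = word_perm w \<circ> Transposition.transpose i j"
      by (rule sigma_comp_word_perm)
    then show ?thesis by (intro Cons.prems(1)[of w]) (auto simp: fun_eq_iff sigma_def)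
  qed
qed

lemma len_transpose_less:
  assumes "p permutes {1..n}" "i < j" "p i > p j"
  shows "len n (p \<circ> Transposition.transpose i j) < len n p"
proof -
  obtain w where w: "reduced n w" "word_perm w = p" using reduced_word assms(1) by blast
  obtain u where u: "subseq u w" "Suc (length u) = length w"
    "word_perm u = p \<circ> Transposition.transpose i j"
    using strong_exchange[of i j w] assms w by blast
  have "len n (p \<circ> Transposition.transpose i j) \<le> length u"
    using len_le[of n u] u w is_word_subseq reduced_def by metis
  then show ?thesis using u w by (auto simp: reduced_def)
qed

lemma len_less_transpose:
  assumes "p permutes {1..n}" "1 \<le> i" "i < j" "j \<le> n" "p i < p j"
  shows "len n p < len n (p \<circ> Transposition.transpose i j)"
proof -
  let ?q = "p \<circ> Transposition.transpose i j"
  have "?q permutes {1..n}"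
    using assms by (intro permutes_compose permutes_swap_id) auto
  moreover have "?q i > ?q j" using assms by simp
  ultimately have "len n (?q \<circ> Transposition.transpose i j) < len n ?q"
    using len_transpose_less assms(3) by blast
  then show ?thesis by (simp add: comp_assoc)
qed

text \<open>Trades the comparison of lengths for a comparison of two values: by strong exchange,
  swapping an inverted pair shortens the permutation, and the same fact for the swapped permutation
  gives the other direction.\<close>

lemma bruhat_step_iff:
  "bruhat_step n u x \<longleftrightarrow> u permutes {1..n} \<and>
     (\<exists>i j. 1 \<le> i \<and> i < j \<and> j \<le> n \<and> x = u \<circ> Transposition.transpose i j \<and> u i < u j)"
proof -
  have "u i < u j" if "u permutes {1..n}" "i < j"
    "len n u < len n (u \<circ> Transposition.transpose i j)" for i j
    using that len_transpose_less[of u n i j] permutes_inj[OF that(1)]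
    by (metis injD less_asym linorder_neqE_nat)
  then show ?thesis unfolding bruhat_step_def using len_less_transpose by blast
qed

lemma bruhat_step_permutes: "bruhat_step n u x \<Longrightarrow> x permutes {1..n}"
  unfolding bruhat_step_def by (auto intro!: permutes_compose permutes_swap_id)

section \<open>The subword property of the Bruhat order\<close>

lemma bruhat_le_refl: "u permutes {1..n} \<Longrightarrow> bruhat_le n u u"
  by (simp add: bruhat_le_def)

lemma bruhat_le_trans: "bruhat_le n u x \<Longrightarrow> bruhat_le n x y \<Longrightarrow> bruhat_le n u y"
  by (auto simp: bruhat_le_def)

lemma bruhat_step_le: "bruhat_step n u x \<Longrightarrow> bruhat_le n u x"
  unfolding bruhat_le_def by (metis bruhat_step_def r_into_rtranclp)

text \<open>Every step down undoes an inversion, which by \<open>strong_exchange\<close> amounts to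
  deleting one letter; the deletions along the chain add up to a subword.\<close>

lemma bruhat_le_subseq:
  assumes "bruhat_le n u (word_perm w)"
  obtains w' where "subseq w' w" "word_perm w' = u"
proof -
  have "(bruhat_step n)\<^sup>*\<^sup>* u (word_perm w)" using assms by (simp add: bruhat_le_def)
  then have "\<exists>w'. subseq w' w \<and> word_perm w' = u"
  proof (induction rule: converse_rtranclp_induct)
    case base
    then show ?case by blast
  next
    case (step y z)
    then obtain w' where w': "subseq w' w" "word_perm w' = z" by blast
    obtain i j where ij: "i < j" "z = y \<circ> Transposition.transpose i j" "y i < y j"
      using step(1) by (auto simp: bruhat_step_iff)
    then have "word_perm w' i > word_perm w' j" by (simp add: w')
    then obtain w'' where "subseq w'' w'" "word_perm w'' = z \<circ> Transposition.transpose i j"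
      using strong_exchange[of i j w'] ij w' by metis
    then show ?case using ij w' by (metis comp_assoc comp_id transpose_comp_involutory subseq_order.order_trans)
  qed
  with that show ?thesis by blast
qed

text \<open>A form of reducedness that can be checked letter by letter and does not mention
  \<open>n\<close>: each letter, when prepended, swaps two values that stand in order and so creates
  an inversion.\<close>

fun ascending_word :: "nat list \<Rightarrow> bool" where
  "ascending_word [] \<longleftrightarrow> True"
| "ascending_word (k # w) \<longleftrightarrow>
     ascending_word w \<and> (\<exists>i j. i < j \<and> word_perm w i = k \<and> word_perm w j = Suc k)"

lemma ascending_step:
  assumes "is_word n (k # w)" "i < j" "word_perm w i = k" "word_perm w j = Suc k"
  shows "bruhat_step n (word_perm w) (sigma k \<circ> word_perm w)"
proof -
  have p: "word_perm w permutes {1..n}" using assms word_perm_permutes by simp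
  then have "i \<in> {1..n}" "j \<in> {1..n}"
    using assms permutes_in_image[OF p, of i] permutes_in_image[OF p, of j] by auto
  with p assms sigma_comp_word_perm[of w i k j] show ?thesis
    unfolding bruhat_step_iff by (intro conjI exI[of _ i] exI[of _ j]) auto
qed

lemma bruhat_step_len: "bruhat_step n u x \<Longrightarrow> len n u < len n x"
  unfolding bruhat_step_def by blast

lemma ascending_reduced: "ascending_word w \<Longrightarrow> is_word n w \<Longrightarrow> reduced n w"
proof (induction w)
  case Nil
  then show ?case using len_le[of n "[]"] by (simp add: reduced_def)
next
  case (Cons k w)
  then have "len n (word_perm w) < len n (sigma k \<circ> word_perm w)"
    using ascending_step bruhat_step_len by auto
  then show ?case using Cons len_le[of n "k # w"] by (auto simp: reduced_def)
qed

text \<open>The deletion property. If prepending \<open>k\<close> fails to ascend, the values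
  \<open>k\<close> and \<open>Suc k\<close> are already inverted in \<open>w\<close>, so strong
  exchange finds a letter of \<open>w\<close> that cancels against \<open>k\<close>.\<close>

lemma ascending_or_shorter:
  "ascending_word w \<or> (\<exists>u. subseq u w \<and> length u < length w \<and> word_perm u = word_perm w)"
proof (induction w)
  case (Cons k w)
  show ?case
  proof (cases "ascending_word w")
    case True
    obtain i where i: "word_perm w i = k" using word_perm_surj .
    obtain j where j: "word_perm w j = Suc k" using word_perm_surj .
    consider "i < j" | "j < i" using i j by (metis linorder_neqE_nat n_not_Suc_n)
    then show ?thesis
    proof cases
      case 1
      then show ?thesis using True i j by auto
    next
      case 2
      then obtain u where "subseq u w" "Suc (length u) = length w"
        "word_perm u = word_perm w \<circ> Transposition.transpose j i"
        using strong_exchange[of j i w] i j by (metis lessI)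
      then show ?thesis using sigma_comp_word_perm[OF i j]
        by (auto simp: transpose_commute intro!: exI[of _ u])
    qed
  next
    case False
    then obtain u where "subseq u w" "length u < length w" "word_perm u = word_perm w"
      using Cons by blast
    then show ?thesis by (intro disjI2 exI[of _ "k # u"]) auto
  qed
qed simp

lemma reduced_ascending: "reduced n w \<Longrightarrow> ascending_word w"
  using ascending_or_shorter[of w] len_le is_word_subseq
  by (metis leD reduced_def)

text \<open>Extracts a reduced word without leaving the given one, so that a subword representing a
  given permutation can be assumed reduced.\<close>

lemma reduced_subseq:
  obtains u where "subseq u w" "ascending_word u" "word_perm u = word_perm w"
proof (induction w arbitrary: thesis rule: length_induct)
  case (1 w)
  show ?case
  proof (cases "ascending_word w")
    case False
    then obtain u where "subseq u w" "length u < length w" "word_perm u = word_perm w"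
      using ascending_or_shorter by blast
    with 1 show ?thesis by (metis subseq_order.order_trans)
  qed (use 1 in blast)
qed

text \<open>The lifting property. A step from \<open>y\<close> to \<open>z\<close> survives
  multiplication by \<open>sigma k\<close> unless it swaps exactly the values \<open>k\<close> and
  \<open>Suc k\<close>; then \<open>sigma k \<circ> y = z\<close>, which lies below \<open>x\<close>
  and hence below \<open>sigma k \<circ> x\<close>.\<close>

lemma bruhat_le_sigma:
  assumes "bruhat_le n u x" "1 \<le> k" "k < n" "bruhat_step n x (sigma k \<circ> x)"
  shows "bruhat_le n (sigma k \<circ> u) (sigma k \<circ> x)"
proof -
  have s: "sigma k permutes {1..n}"
    unfolding sigma_def using assms by (intro permutes_swap_id) auto
  have "(bruhat_step n)\<^sup>*\<^sup>* u x" using assms by (simp add: bruhat_le_def)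
  then show ?thesis
  proof (induction rule: converse_rtranclp_induct)
    case base
    then show ?case using assms s bruhat_step_permutes bruhat_le_refl by blast
  next
    case (step y z)
    obtain i j where ij: "y permutes {1..n}" "1 \<le> i" "i < j" "j \<le> n"
      "z = y \<circ> Transposition.transpose i j" "y i < y j"
      using step(1) by (auto simp: bruhat_step_iff)
    show ?case
    proof (cases "sigma k (y i) < sigma k (y j)")
      case True
      have "bruhat_step n (sigma k \<circ> y) (sigma k \<circ> z)"
        unfolding bruhat_step_iff using True ij s
        by (auto simp: comp_assoc intro!: permutes_compose)
      then show ?thesis using step.IH bruhat_step_le bruhat_le_trans by blast
    next
      case False
      then have "y i = k" "y j = Suc k" using ij(6) by (auto simp: sigma_apply split: if_splits)
      moreover obtain w where "word_perm w = y" using permutes_word ij(1) by blast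
      ultimately have "sigma k \<circ> y = z" using sigma_comp_word_perm ij(5) by auto
      moreover have "bruhat_le n z x"
        using step bruhat_step_permutes by (auto simp: bruhat_le_def)
      ultimately show ?thesis using assms(4) bruhat_step_le bruhat_le_trans by blast
    qed
  qed
qed

text \<open>Converse of \<open>bruhat_le_subseq\<close>: omitting a first letter loses one ascending
  step, and keeping it on both sides is the lifting property.\<close>

lemma subseq_bruhat_le:
  assumes "ascending_word w" "is_word n w" "subseq u w"
  shows "bruhat_le n (word_perm u) (word_perm w)"
  using assms(3,1,2)
proof (induction rule: list_emb.induct)
  case (list_emb_Nil ys)
  then show ?case
  proof (induction ys)
    case Nil
    then show ?case by (simp only: word_perm_Nil bruhat_le_refl permutes_id)
  next
    case (Cons k w)
    then have "bruhat_le n (word_perm w) (word_perm (k # w))"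
      using ascending_step[of n k w] bruhat_step_le by auto
    then show ?case using Cons bruhat_le_trans by (metis ascending_word.simps(2) is_word_simps(2))
  qed
next
  case (list_emb_Cons xs ys y)
  then have "bruhat_le n (word_perm ys) (word_perm (y # ys))"
    using ascending_step[of n y ys] bruhat_step_le by auto
  then show ?case
    using list_emb_Cons bruhat_le_trans by (metis ascending_word.simps(2) is_word_simps(2))
next
  case (list_emb_Cons2 x y xs ys)
  then obtain i j where "i < j" "word_perm ys i = y" "word_perm ys j = Suc y" by auto
  then have "bruhat_step n (word_perm ys) (sigma y \<circ> word_perm ys)"
    using ascending_step list_emb_Cons2.prems by blast
  then show ?case using list_emb_Cons2 bruhat_le_sigma[of n "word_perm xs" "word_perm ys" y]
    by (simp add: o_def)
qed

section \<open>Collapses and homology modulo 2\<close>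

\<comment> \<open>By default the simplifier rewrites sums in \<open>bit\<close> to \<open>XOR\<close>, which blocks the rules for \<open>sum\<close>.\<close>
declare add_bit_eq_xor [simp del] mult_bit_eq_and [simp del]
  bit_not_zero_iff [simp del] bit_not_one_iff [simp del]

text \<open>The simplicial boundary modulo 2, given by its coefficient at \<open>G\<close>. Since
  \<open>G = {}\<close> is allowed, the resulting homology is reduced.\<close>

definition bd :: "'a set \<Rightarrow> ('a set \<Rightarrow> bit) \<Rightarrow> 'a set \<Rightarrow> bit" where
  "bd V c G = (\<Sum>x\<in>V - G. c (insert x G))"

lemma bit_add_self: "(a::bit) + a = 0"
  by (cases a) simp_all

lemma bd_add: "bd V (\<lambda>F. a F + b F) G = bd V a G + bd V b G"
  by (simp add: bd_def sum.distrib)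

lemma bd_scale: "bd V (\<lambda>F. m * a F) G = m * bd V a G"
  by (simp add: bd_def sum_distrib_left)

text \<open>The reason for \<open>bd_bd\<close>: every unordered pair contributes twice.\<close>

lemma sum_offdiag_bit:
  fixes h :: "'a \<Rightarrow> 'a \<Rightarrow> bit"
  assumes "finite S" "\<And>x y. h x y = h y x"
  shows "(\<Sum>x\<in>S. \<Sum>y\<in>S - {x}. h x y) = 0"
  using assms(1)
proof (induction S rule: finite_induct)
  case (insert a S)
  have "(\<Sum>x\<in>S. \<Sum>y\<in>insert a S - {x}. h x y) = (\<Sum>x\<in>S. h a x + (\<Sum>y\<in>S - {x}. h x y))"
  proof (rule sum.cong)
    fix x assume "x \<in> S"
    then have "insert a S - {x} = insert a (S - {x})" using insert by auto
    then show "(\<Sum>y\<in>insert a S - {x}. h x y) = h a x + (\<Sum>y\<in>S - {x}. h x y)"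
      using insert assms(2)[of x a] by simp
  qed simp
  then show ?case using insert
    by (simp add: sum.distrib add.assoc[symmetric] bit_add_self)
qed simp

lemma bd_bd:
  assumes "finite V"
  shows "bd V (bd V c) G = 0"
proof -
  have "bd V (bd V c) G = (\<Sum>x\<in>V - G. \<Sum>y\<in>(V - G) - {x}. c (insert x (insert y G)))"
    unfolding bd_def by (intro sum.cong) (auto simp: insert_commute)
  also have "\<dots> = 0" using assms by (intro sum_offdiag_bit) (auto simp: insert_commute)
  finally show ?thesis .
qed

lemma bd_nonzeroE:
  assumes "bd V c G \<noteq> 0"
  obtains x where "x \<in> V - G" "c (insert x G) \<noteq> 0"
  using assms unfolding bd_def by (meson sum.not_neutral_contains_not_neutral)

text \<open>Chains on faces containing \<open>A\<close> are chains of the link of \<open>A\<close>,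
  and the induction on \<N> passes to smaller links. Moving a nonface from the cover into
  \<open>A\<close> lowers \<open>card \<C>\<close> by one and raises \<open>d\<close> by one, so the
  bound \<open>card V\<close> persists. When no nonface is left, the link is the full simplex on
  \<open>V - A\<close>; the covering hypothesis makes \<open>V - A\<close> nonempty, and the simplex
  is a cone.\<close>

lemma cycle_boundary_uncovered:
  fixes V :: "'a set" and c :: "'a set \<Rightarrow> bit"
  assumes "finite V" "finite \<N>" "A \<subseteq> V"
    and supp: "\<And>F. c F \<noteq> 0 \<Longrightarrow> A \<subseteq> F \<and> F \<subseteq> V \<and> card F = d \<and> (\<forall>N\<in>\<N>. \<not> N \<subseteq> F)"
    and cyc: "\<And>G. A \<subseteq> G \<Longrightarrow> G \<subseteq> V \<Longrightarrow> bd V c G = 0"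
    and uncov: "\<And>\<C>. \<C> \<subseteq> \<N> \<Longrightarrow> card \<C> + d \<le> card V \<Longrightarrow> \<not> V \<subseteq> A \<union> \<Union>\<C>"
  shows "\<exists>e. (\<forall>F. e F \<noteq> 0 \<longrightarrow> A \<subseteq> F \<and> F \<subseteq> V \<and> card F = Suc d \<and> (\<forall>N\<in>\<N>. \<not> N \<subseteq> F))
    \<and> (\<forall>G. A \<subseteq> G \<and> G \<subseteq> V \<longrightarrow> bd V e G = c G)"
  using assms(2,3) supp cyc uncov
proof (induction \<N> arbitrary: A c d rule: finite_induct)
  case empty
  show ?case
  proof (cases "d \<le> card V")
    case False
    then have "c F = 0" for F using empty.prems(2) card_mono[OF \<open>finite V\<close>] by metis
    then show ?thesis by (intro exI[of _ "\<lambda>_. 0"]) (simp add: bd_def)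
  next
    case True
    then obtain v where v: "v \<in> V" "v \<notin> A" using empty.prems(4)[of "{}"] by auto
    \<comment> \<open>The cone over \<open>c\<close> with apex \<open>v\<close>. At a face through
      \<open>v\<close> its boundary is computed from the cycle condition at
      \<open>G - {v}\<close>.\<close>
    define e where "e F = (if v \<in> F then c (F - {v}) else 0)" for F
    have "bd V e G = c G" if G: "A \<subseteq> G" "G \<subseteq> V" for G
    proof (cases "v \<in> G")
      case True
      have "V - (G - {v}) = insert v (V - G)" using True v by auto
      then have "0 = c G + (\<Sum>x\<in>V - G. c (insert x (G - {v})))"
        using empty.prems(3)[of "G - {v}"] G v True \<open>finite V\<close>
        by (auto simp: bd_def insert_absorb)
      also have "(\<Sum>x\<in>V - G. c (insert x (G - {v}))) = bd V e G"
        unfolding bd_def e_def using True by (intro sum.cong) (auto simp: insert_Diff_if)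
      finally show ?thesis by (metis bit_add_self add_left_cancel)
    next
      case False
      have "bd V e G = (\<Sum>x\<in>V - G. if x = v then c G else 0)"
        unfolding bd_def e_def using False by (intro sum.cong) auto
      then show ?thesis using \<open>finite V\<close> v False by (simp add: sum.delta)
    qed
    moreover have "A \<subseteq> F \<and> F \<subseteq> V \<and> card F = Suc d" if "e F \<noteq> 0" for F
    proof -
      have F: "v \<in> F" "c (F - {v}) \<noteq> 0" using that by (auto simp: e_def split: if_splits)
      then have *: "A \<subseteq> F - {v}" "F - {v} \<subseteq> V" "card (F - {v}) = d" using empty.prems(2) by auto
      then have "finite F" using \<open>finite V\<close> finite_subset by fastforce
      then have "Suc (card (F - {v})) = card F" using F by (intro card_Suc_Diff1)
      then show ?thesis using * v F by auto
    qed
    ultimately show ?thesis by (intro exI[of _ e]) blast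
  qed
next
  case (insert N \<N>)
  have "\<exists>e. (\<forall>F. e F \<noteq> 0 \<longrightarrow> A \<subseteq> F \<and> F \<subseteq> V \<and> card F = Suc d \<and> (\<forall>N\<in>\<N>. \<not> N \<subseteq> F))
    \<and> (\<forall>G. A \<subseteq> G \<and> G \<subseteq> V \<longrightarrow> bd V e G = c G)"
  proof (intro insert.IH)
    show "\<not> V \<subseteq> A \<union> \<Union>\<C>" if "\<C> \<subseteq> \<N>" "card \<C> + d \<le> card V" for \<C>
      using insert.prems(4) that by blast
    show "A \<subseteq> F \<and> F \<subseteq> V \<and> card F = d \<and> (\<forall>N\<in>\<N>. \<not> N \<subseteq> F)" if "c F \<noteq> 0" for F
      using insert.prems(2)[OF that] by blast
  qed (use insert.prems in blast)+
  then obtain e where e: "\<And>F. e F \<noteq> 0 \<Longrightarrow> A \<subseteq> F \<and> F \<subseteq> V \<and> card F = Suc d \<and> (\<forall>N\<in>\<N>. \<not> N \<subseteq> F)"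
    "\<And>G. A \<subseteq> G \<Longrightarrow> G \<subseteq> V \<Longrightarrow> bd V e G = c G" by metis
  show ?case
  proof (cases "N \<subseteq> V")
    case False
    then show ?thesis using e by (intro exI[of _ e]) blast
  next
    case True
    \<comment> \<open>The faces of \<open>e\<close> containing \<open>N\<close> form a cycle in the link of \<open>N\<close>.\<close>
    define e1 where "e1 F = (if N \<subseteq> F then e F else 0)" for F
    have "\<exists>g. (\<forall>F. g F \<noteq> 0 \<longrightarrow> A \<union> N \<subseteq> F \<and> F \<subseteq> V \<and> card F = Suc (Suc d) \<and> (\<forall>N\<in>\<N>. \<not> N \<subseteq> F))
      \<and> (\<forall>G. A \<union> N \<subseteq> G \<and> G \<subseteq> V \<longrightarrow> bd V g G = e1 G)"
    proof (intro insert.IH)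
      show "A \<union> N \<subseteq> V" using True insert.prems by auto
      show "A \<union> N \<subseteq> F \<and> F \<subseteq> V \<and> card F = Suc d \<and> (\<forall>N\<in>\<N>. \<not> N \<subseteq> F)" if "e1 F \<noteq> 0" for F
        using that e(1)[of F] by (auto simp: e1_def split: if_splits)
      show "bd V e1 G = 0" if G: "A \<union> N \<subseteq> G" "G \<subseteq> V" for G
      proof -
        have "bd V e1 G = bd V e G"
          unfolding bd_def e1_def using G by (intro sum.cong) auto
        \<comment> \<open>The chain \<open>c\<close> avoids supersets of \<open>N\<close>, so the
          boundary of \<open>e\<close> vanishes there; cofaces of such a \<open>G\<close> contain
          \<open>N\<close> as well, so \<open>e1\<close> and \<open>e\<close> have the same boundary
          at \<open>G\<close>.\<close>
        moreover have "c G = 0" using insert.prems(2)[of G] G by auto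
        ultimately show ?thesis using e(2)[of G] G by simp
      qed
      show "\<not> V \<subseteq> (A \<union> N) \<union> \<Union>\<C>" if "\<C> \<subseteq> \<N>" "card \<C> + Suc d \<le> card V" for \<C>
      proof -
        have "finite \<C>" using that(1) insert.hyps(1) by (rule finite_subset)
        then have "card (insert N \<C>) + d \<le> card V" using that by (simp add: card_insert_if)
        moreover have "insert N \<C> \<subseteq> insert N \<N>" using that(1) by blast
        ultimately have "\<not> V \<subseteq> A \<union> \<Union>(insert N \<C>)" by (intro insert.prems(4))
        then show ?thesis by (simp add: Un_assoc)
      qed
    qed
    then obtain g where g: "\<And>F. g F \<noteq> 0 \<Longrightarrow> A \<union> N \<subseteq> F \<and> F \<subseteq> V \<and> card F = Suc (Suc d) \<and> (\<forall>N\<in>\<N>. \<not> N \<subseteq> F)"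
      "\<And>G. A \<union> N \<subseteq> G \<Longrightarrow> G \<subseteq> V \<Longrightarrow> bd V g G = e1 G" by metis
    \<comment> \<open>As \<open>g\<close> fills \<open>e1\<close>, its boundary cancels every face
      of \<open>e\<close> through \<open>N\<close> and does not change the boundary of
      \<open>e\<close>. The truncation drops the faces of \<open>bd V g\<close> that miss part of
      \<open>A\<close>.\<close>
    define e' where "e' F = (if A \<subseteq> F \<and> F \<subseteq> V then e F + bd V g F else 0)" for F
    have "bd V e' G = c G" if G: "A \<subseteq> G" "G \<subseteq> V" for G
    proof -
      have "bd V e' G = bd V (\<lambda>F. e F + bd V g F) G"
        unfolding bd_def[of V e'] bd_def[of V "\<lambda>F. e F + bd V g F"] e'_def
        using G by (intro sum.cong) auto
      then show ?thesis using e(2)[of G] G bd_bd[OF \<open>finite V\<close>] by (simp add: bd_add)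
    qed
    moreover have "A \<subseteq> F \<and> F \<subseteq> V \<and> card F = Suc d \<and> (\<forall>N\<in>insert N \<N>. \<not> N \<subseteq> F)"
      if "e' F \<noteq> 0" for F
    proof -
      have F: "A \<subseteq> F" "F \<subseteq> V" "e F + bd V g F \<noteq> 0"
        using that by (auto simp: e'_def split: if_splits)
      have "\<not> N \<subseteq> F"
        using g(2)[of F] F bit_add_self by (auto simp: e1_def)
      moreover have "card F = Suc d \<and> (\<forall>N\<in>\<N>. \<not> N \<subseteq> F)"
      proof (cases "e F = 0")
        case False
        then show ?thesis using e(1)[of F] by blast
      next
        case True
        then have "bd V g F \<noteq> 0" using F by simp
        then obtain x where x: "x \<in> V - F" "g (insert x F) \<noteq> 0" by (rule bd_nonzeroE)
        have "finite F" using F \<open>finite V\<close> finite_subset by blast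
        then show ?thesis using g(1)[OF x(2)] x(1) by auto
      qed
      ultimately show ?thesis using F by auto
    qed
    ultimately show ?thesis by (intro exI[of _ e']) blast
  qed
qed

text \<open>Vanishing reduced homology at the faces with \<open>d - 1\<close> elements. The index is
  the size of the filling faces: the boundary of a face is tested at the size of that face without a
  predecessor, and at \<open>d = 0\<close> only the zero chain qualifies.\<close>

definition exact_at :: "'a set \<Rightarrow> 'a set set \<Rightarrow> nat \<Rightarrow> bool" where
  "exact_at V K d \<longleftrightarrow> (\<forall>c. (\<forall>F. c F \<noteq> 0 \<longrightarrow> F \<in> K \<and> Suc (card F) = d) \<and> (\<forall>G\<in>Pow V. bd V c G = 0)
     \<longrightarrow> (\<exists>e. (\<forall>F. e F \<noteq> 0 \<longrightarrow> F \<in> K \<and> card F = d) \<and> (\<forall>G\<in>Pow V. bd V e G = c G)))"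

lemma exact_atD:
  assumes "exact_at V K d"
    and "\<And>F. c F \<noteq> 0 \<Longrightarrow> F \<in> K \<and> Suc (card F) = d" "\<And>G. G \<subseteq> V \<Longrightarrow> bd V c G = 0"
  shows "\<exists>e. (\<forall>F. e F \<noteq> 0 \<longrightarrow> F \<in> K \<and> card F = d) \<and> (\<forall>G. G \<subseteq> V \<longrightarrow> bd V e G = c G)"
proof -
  have "(\<forall>F. c F \<noteq> 0 \<longrightarrow> F \<in> K \<and> Suc (card F) = d) \<and> (\<forall>G\<in>Pow V. bd V c G = 0)"
    using assms(2,3) by (intro conjI allI impI ballI) simp_all
  with assms(1) have "\<exists>e. (\<forall>F. e F \<noteq> 0 \<longrightarrow> F \<in> K \<and> card F = d) \<and> (\<forall>G\<in>Pow V. bd V e G = c G)"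
    unfolding exact_at_def by (elim allE impE)
  then show ?thesis by (simp add: Ball_def)
qed

lemma exact_atI:
  assumes "\<And>c. (\<And>F. c F \<noteq> 0 \<Longrightarrow> F \<in> K \<and> Suc (card F) = d) \<Longrightarrow> (\<And>G. G \<subseteq> V \<Longrightarrow> bd V c G = 0) \<Longrightarrow>
    \<exists>e. (\<forall>F. e F \<noteq> 0 \<longrightarrow> F \<in> K \<and> card F = d) \<and> (\<forall>G. G \<subseteq> V \<longrightarrow> bd V e G = c G)"
  shows "exact_at V K d"
  unfolding exact_at_def using assms by (simp add: Ball_def)

section \<open>Elementary collapses and the critical face\<close>

definition single_chain :: "'a set \<Rightarrow> 'a set \<Rightarrow> bit" where
  "single_chain Y F = (if F = Y then 1 else 0)"

lemma bd_single_chain: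
  assumes "finite V" "Y \<subseteq> V"
  shows "bd V (single_chain Y) F = (if \<exists>x\<in>Y. F = Y - {x} then 1 else 0)"
proof (cases "\<exists>x\<in>Y. F = Y - {x}")
  case True
  then obtain x where x: "x \<in> Y" "F = Y - {x}" by blast
  have "bd V (single_chain Y) F = (\<Sum>y\<in>V - F. if y = x then 1 else 0)"
    unfolding bd_def
  proof (intro sum.cong refl)
    fix y assume "y \<in> V - F"
    then have "insert y F = Y \<longleftrightarrow> y = x" using x by auto
    then show "single_chain Y (insert y F) = (if y = x then 1 else 0)" by (simp add: single_chain_def)
  qed
  moreover have "x \<in> V - F" "finite (V - F)" using x assms by auto
  ultimately show ?thesis using True by (simp only: sum.delta if_True)
next
  case False
  have "bd V (single_chain Y) F = 0"
    unfolding bd_def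
  proof (intro sum.neutral ballI)
    fix y assume "y \<in> V - F"
    then have "insert y F \<noteq> Y" using False by auto
    then show "single_chain Y (insert y F) = 0" by (simp add: single_chain_def)
  qed
  then show ?thesis using False by simp
qed

lemma bd_single_chainE:
  assumes "finite V" "Y \<subseteq> V" "bd V (single_chain Y) F \<noteq> 0"
  obtains x where "x \<in> Y" "F = Y - {x}"
proof (cases "\<exists>x\<in>Y. F = Y - {x}")
  case False
  then have "bd V (single_chain Y) F = 0" using bd_single_chain[OF assms(1,2), of F] by (simp only: if_False)
  then show ?thesis using assms(3) by simp
qed (use that in blast)

text \<open>Here \<open>X\<close> is a free face of \<open>Y\<close> in
  \<open>K \<union> {X, Y}\<close>: as \<open>K\<close> is closed under subsets and misses
  \<open>X\<close>, no member of \<open>K\<close> contains \<open>X\<close>.\<close>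

locale elementary_collapse =
  fixes V :: "'a set" and K :: "'a set set" and X Y :: "'a set"
  assumes finV: "finite V" and KV: "K \<subseteq> Pow V" and YV: "Y \<subseteq> V"
    and XY: "X \<subseteq> Y" "card Y = Suc (card X)"
    and XK: "X \<notin> K" "Y \<notin> K"
    and downK: "\<And>F G. F \<in> K \<Longrightarrow> G \<subseteq> F \<Longrightarrow> G \<in> K"
    and downK': "\<And>F G. F \<in> K \<union> {X, Y} \<Longrightarrow> G \<subseteq> F \<Longrightarrow> G \<in> K \<union> {X, Y}"
begin

lemma XY_remove: obtains x where "x \<in> Y" "X = Y - {x}" "x \<notin> X" "Y = insert x X"
proof -
  have "finite Y" using YV finV by (rule finite_subset)
  then have "finite X" using XY(1) by (rule finite_subset[rotated])
  then have "card (Y - X) = 1" using XY by (simp add: card_Diff_subset)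
  then obtain x where "Y - X = {x}" by (meson card_1_singletonE)
  then have "x \<in> Y" "X = Y - {x}" "x \<notin> X" "Y = insert x X" using XY(1) by blast+
  then show ?thesis by (rule that)
qed

lemma bd_Y_X: "bd V (single_chain Y) X = 1"
proof -
  obtain x where "x \<in> Y" "X = Y - {x}" by (rule XY_remove)
  then show ?thesis using bd_single_chain[OF finV YV, of X] by auto
qed

lemma bd_Y_Y: "bd V (single_chain Y) Y = 0"
  by (simp add: bd_single_chain[OF finV YV]) blast

lemma bd_at_X:
  assumes "\<And>F. f F \<noteq> 0 \<Longrightarrow> F \<in> K \<union> {X, Y}"
  shows "bd V f X = f Y"
proof -
  obtain x where x: "x \<in> Y" "X = Y - {x}" "x \<notin> X" "Y = insert x X" using XY_remove .
  have "f (insert y X) = 0" if "y \<in> V - X" "y \<noteq> x" for y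
  proof (rule ccontr)
    assume "f (insert y X) \<noteq> 0"
    then have "insert y X \<in> K \<union> {X, Y}" using assms by blast
    moreover have "insert y X \<noteq> X" "insert y X \<noteq> Y" using that x(4) by auto
    ultimately have "insert y X \<in> K" by simp
    then have "X \<in> K" using downK[of "insert y X" X] by auto
    then show False using XK(1) by simp
  qed
  then have "bd V f X = (\<Sum>y\<in>V - X. if y = x then f Y else 0)"
    unfolding bd_def using x(4) by (intro sum.cong) auto
  moreover have "x \<in> V - X" "finite (V - X)" using finV YV x(1,3) by auto
  ultimately show ?thesis by (simp only: sum.delta if_True)
qed

lemma bd_Y_supp:
  assumes "bd V (single_chain Y) F \<noteq> 0"
  shows "F \<in> K \<union> {X}" "Suc (card F) = card Y"
proof -
  obtain x where x: "x \<in> Y" "F = Y - {x}"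
    using bd_single_chainE[OF finV YV assms] .
  then show "F \<in> K \<union> {X}" using downK'[of Y F] by auto
  have "finite Y" using YV finV by (rule finite_subset)
  then show "Suc (card F) = card Y" unfolding x(2) using x(1) by (rule card_Suc_Diff1)
qed

text \<open>A filling cannot use \<open>Y\<close>, because its coefficient there is that of its
  boundary at the free face \<open>X\<close>, which is 0. If it uses \<open>X\<close>, adding the
  boundary of \<open>Y\<close> replaces \<open>X\<close> by faces in \<open>K\<close> and keeps the
  boundary.\<close>

lemma exact_at_collapse:
  assumes ex: "exact_at V (K \<union> {X, Y}) d"
  shows "exact_at V K d"
proof (rule exact_atI)
  fix c assume c: "\<And>F. c F \<noteq> 0 \<Longrightarrow> F \<in> K \<and> Suc (card F) = d" "\<And>G. G \<subseteq> V \<Longrightarrow> bd V c G = 0"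
  have *: "F \<in> K \<union> {X, Y} \<and> Suc (card F) = d" if "c F \<noteq> 0" for F using c(1)[OF that] by simp
  have "\<exists>f. (\<forall>F. f F \<noteq> 0 \<longrightarrow> F \<in> K \<union> {X, Y} \<and> card F = d) \<and> (\<forall>G. G \<subseteq> V \<longrightarrow> bd V f G = c G)"
    by (rule exact_atD[OF ex]) (erule *, rule c(2), assumption)
  then obtain f where "\<forall>F. f F \<noteq> 0 \<longrightarrow> F \<in> K \<union> {X, Y} \<and> card F = d"
    "\<forall>G. G \<subseteq> V \<longrightarrow> bd V f G = c G"
    by (elim exE conjE)
  note f = this[rule_format]
  have "c X = 0" using c(1)[of X] XK by auto
  moreover have "bd V f X = f Y" using f(1) by (intro bd_at_X) simp
  ultimately have fY: "f Y = 0" using f(2)[of X] XY(1) YV by auto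
  define m where "m = f X"
  define f' where "f' F = f F + m * bd V (single_chain Y) F" for F
  have m: "card X = d" if "m \<noteq> 0" using that f(1)[of X] by (simp add: m_def)
  have "f' X = 0" by (simp add: f'_def m_def bd_Y_X bit_add_self)
  moreover have "f' Y = 0" by (simp add: f'_def fY bd_Y_Y)
  moreover have "F \<in> K \<union> {X, Y} \<and> card F = d" if "f' F \<noteq> 0" for F
  proof (cases "f F = 0")
    case True
    then have "m \<noteq> 0" "bd V (single_chain Y) F \<noteq> 0" using that by (auto simp: f'_def)
    then show ?thesis using bd_Y_supp[of F] XY(2) m by auto
  qed (rule f(1))
  ultimately have "F \<in> K \<and> card F = d" if "f' F \<noteq> 0" for F
    using that by (cases "F = X"; cases "F = Y") auto
  moreover have "bd V f' G = bd V f G" for G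
    unfolding f'_def by (simp add: bd_add bd_scale bd_bd[OF finV])
  ultimately show "\<exists>e. (\<forall>F. e F \<noteq> 0 \<longrightarrow> F \<in> K \<and> card F = d) \<and> (\<forall>G. G \<subseteq> V \<longrightarrow> bd V e G = c G)"
    using f(2) by (intro exI[of _ f'] conjI allI impI) simp_all
qed

text \<open>A cycle that uses \<open>X\<close> is pushed into \<open>K\<close> by adding the
  boundary of \<open>Y\<close>; it is filled there, and adding \<open>Y\<close> to the filling makes
  up for the push.\<close>

lemma exact_at_expand:
  assumes ex: "exact_at V K d"
  shows "exact_at V (K \<union> {X, Y}) d"
proof (rule exact_atI)
  fix c assume c: "\<And>F. c F \<noteq> 0 \<Longrightarrow> F \<in> K \<union> {X, Y} \<and> Suc (card F) = d"
    "\<And>G. G \<subseteq> V \<Longrightarrow> bd V c G = 0"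
  have "bd V c X = c Y" using c(1) by (intro bd_at_X) simp
  then have cY: "c Y = 0" using c(2)[of X] XY(1) YV by auto
  define m where "m = c X"
  define c' where "c' F = c F + m * bd V (single_chain Y) F" for F
  have m: "Suc (card X) = d" if "m \<noteq> 0" using that c(1)[of X] by (simp add: m_def)
  have "c' X = 0" by (simp add: c'_def m_def bd_Y_X bit_add_self)
  moreover have "c' Y = 0" by (simp add: c'_def cY bd_Y_Y)
  moreover have "F \<in> K \<union> {X, Y} \<and> Suc (card F) = d" if "c' F \<noteq> 0" for F
  proof (cases "c F = 0")
    case True
    then have "m \<noteq> 0" "bd V (single_chain Y) F \<noteq> 0" using that by (auto simp: c'_def)
    then show ?thesis using bd_Y_supp[of F] XY(2) m by auto
  qed (rule c(1))
  ultimately have c': "F \<in> K \<and> Suc (card F) = d" if "c' F \<noteq> 0" for F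
    using that by (cases "F = X"; cases "F = Y") auto
  have "bd V c' G = bd V c G" for G
    unfolding c'_def by (simp add: bd_add bd_scale bd_bd[OF finV])
  then have *: "bd V c' G = 0" if "G \<subseteq> V" for G using c(2)[OF that] by simp
  have "\<exists>e. (\<forall>F. e F \<noteq> 0 \<longrightarrow> F \<in> K \<and> card F = d) \<and> (\<forall>G. G \<subseteq> V \<longrightarrow> bd V e G = c' G)"
    by (rule exact_atD[OF ex]) (erule c', rule *, assumption)
  then obtain e where "\<forall>F. e F \<noteq> 0 \<longrightarrow> F \<in> K \<and> card F = d"
    "\<forall>G. G \<subseteq> V \<longrightarrow> bd V e G = c' G"
    by (elim exE conjE)
  note e = this[rule_format]
  let ?e = "\<lambda>F. e F + m * single_chain Y F"
  have "bd V ?e G = c G" if "G \<subseteq> V" for G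
    using e(2)[OF that] by (simp add: bd_add bd_scale c'_def add.assoc bit_add_self)
  moreover have "F \<in> K \<union> {X, Y} \<and> card F = d" if "?e F \<noteq> 0" for F
  proof (cases "e F = 0")
    case True
    then have "m \<noteq> 0" "F = Y" using that by (auto simp: single_chain_def split: if_splits)
    then show ?thesis using XY(2) m by auto
  next
    case False
    then show ?thesis using e(1)[of F] by simp
  qed
  ultimately show "\<exists>e. (\<forall>F. e F \<noteq> 0 \<longrightarrow> F \<in> K \<union> {X, Y} \<and> card F = d) \<and> (\<forall>G. G \<subseteq> V \<longrightarrow> bd V e G = c G)"
    by (intro exI[of _ ?e] conjI allI impI) simp_all
qed

end

text \<open>By exactness of \<open>K\<close> the boundary of \<open>Z\<close> is also the boundary
  of some \<open>e\<close> in \<open>K\<close>. The cycle \<open>Z + e\<close> cannot bound after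
  \<open>Z\<close> is added, because no face lies properly above \<open>Z\<close>.\<close>

lemma critical_cell_not_exact:
  assumes "finite V" "Z \<subseteq> V" "Z \<notin> K" "\<And>F. F \<subset> Z \<Longrightarrow> F \<in> K"
    and down: "\<And>F G. F \<in> K \<Longrightarrow> G \<subseteq> F \<Longrightarrow> G \<in> K"
    and ex: "exact_at V K (card Z)"
  shows "\<not> exact_at V (insert Z K) (Suc (card Z))"
proof
  assume ex': "exact_at V (insert Z K) (Suc (card Z))"
  have finZ: "finite Z" using assms(2,1) by (rule finite_subset)
  have *: "F \<in> K \<and> Suc (card F) = card Z" if nz: "bd V (single_chain Z) F \<noteq> 0" for F
  proof -
    obtain x where "x \<in> Z" "F = Z - {x}"
      using bd_single_chainE[OF assms(1,2) nz] .
    then show ?thesis using assms(4)[of F] card_Suc_Diff1[OF finZ] by auto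
  qed
  have "\<exists>e. (\<forall>F. e F \<noteq> 0 \<longrightarrow> F \<in> K \<and> card F = card Z) \<and> (\<forall>G. G \<subseteq> V \<longrightarrow> bd V e G = bd V (single_chain Z) G)"
    by (rule exact_atD[OF ex]) (erule *, rule bd_bd[OF assms(1)])
  then obtain e where "\<forall>F. e F \<noteq> 0 \<longrightarrow> F \<in> K \<and> card F = card Z"
    "\<forall>G. G \<subseteq> V \<longrightarrow> bd V e G = bd V (single_chain Z) G"
    by (elim exE conjE)
  note e = this[rule_format]
  define c where "c F = single_chain Z F + e F" for F
  have bdc: "bd V c G = 0" if "G \<subseteq> V" for G
    unfolding c_def using e(2)[OF that] by (simp add: bd_add bit_add_self)
  have **: "F \<in> insert Z K \<and> Suc (card F) = Suc (card Z)" if "c F \<noteq> 0" for F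
    using that e(1)[of F] by (cases "F = Z") (auto simp: c_def single_chain_def)
  have "\<exists>f. (\<forall>F. f F \<noteq> 0 \<longrightarrow> F \<in> insert Z K \<and> card F = Suc (card Z)) \<and> (\<forall>G. G \<subseteq> V \<longrightarrow> bd V f G = c G)"
    by (rule exact_atD[OF ex']) (erule **, rule bdc, assumption)
  then obtain f where "\<forall>F. f F \<noteq> 0 \<longrightarrow> F \<in> insert Z K \<and> card F = Suc (card Z)"
    "\<forall>G. G \<subseteq> V \<longrightarrow> bd V f G = c G"
    by (elim exE conjE)
  note f = this[rule_format]
  have "bd V f Z = 0"
  proof (rule ccontr)
    assume "bd V f Z \<noteq> 0"
    then obtain x where "x \<in> V - Z" "f (insert x Z) \<noteq> 0" by (rule bd_nonzeroE)
    then have "insert x Z \<in> K" using f(1)[of "insert x Z"] by auto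
    then have "Z \<in> K" using down[of "insert x Z" Z] by auto
    then show False using assms(3) by simp
  qed
  moreover have "e Z = 0" using e(1)[of Z] assms(3) by auto
  ultimately show False using f(2)[OF assms(2)] by (simp add: c_def single_chain_def)
qed

text \<open>The complexes \<open>E k\<close> shrink to the void complex \<open>E l\<close>, which is
  exact in every degree. Going back up, each pair is an expansion and preserves exactness;
  \<open>Z\<close> destroys it in its own degree, and the pairs above \<open>Z\<close> cannot
  restore it.\<close>

lemma matching_not_exact:
  fixes E :: "nat \<Rightarrow> 'a set set"
  assumes fin: "finite V" and EV: "\<And>k. k \<le> l \<Longrightarrow> E k \<subseteq> Pow V" and El: "E l = {}"
    and down: "\<And>k F G. k \<le> l \<Longrightarrow> F \<in> E k \<Longrightarrow> G \<subseteq> F \<Longrightarrow> G \<in> E k"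
    and p: "p < l" "E p = insert Z (E (Suc p))" "Z \<notin> E (Suc p)"
    and pair: "\<And>k. k < l \<Longrightarrow> k \<noteq> p \<Longrightarrow> \<exists>X Y. X \<subseteq> Y \<and> card Y = Suc (card X) \<and>
      E k = E (Suc k) \<union> {X, Y} \<and> X \<notin> E (Suc k) \<and> Y \<notin> E (Suc k)"
  shows "\<not> exact_at V (E 0) (Suc (card Z))"
proof -
  have iff: "exact_at V (E k) d \<longleftrightarrow> exact_at V (E (Suc k)) d" if k: "k < l" "k \<noteq> p" for k d
  proof -
    obtain X Y where P: "X \<subseteq> Y" "card Y = Suc (card X)" "E k = E (Suc k) \<union> {X, Y}"
      "X \<notin> E (Suc k)" "Y \<notin> E (Suc k)" using pair[OF k] by blast
    interpret elementary_collapse V "E (Suc k)" X Y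
    proof
      show "finite V" by (rule fin)
      show "E (Suc k) \<subseteq> Pow V" "Y \<subseteq> V" using EV[of "Suc k"] EV[of k] that P by auto
      show "G \<in> E (Suc k)" if "F \<in> E (Suc k)" "G \<subseteq> F" for F G
        using down that \<open>k < l\<close> by (meson Suc_leI)
      show "G \<in> E (Suc k) \<union> {X, Y}" if "F \<in> E (Suc k) \<union> {X, Y}" "G \<subseteq> F" for F G
        using down[of k F G] that \<open>k < l\<close> P by auto
    qed (use P in auto)
    show ?thesis unfolding P(3) by (rule iffI[OF exact_at_collapse exact_at_expand])
  qed
  have top: "exact_at V (E k) d" if "p < k" "k \<le> l" for k d
    using that(2,1)
  proof (induction k rule: inc_induct)
    case base
    have "bd V (\<lambda>_. 0) G = 0" for G by (simp add: bd_def)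
    then show ?case unfolding exact_at_def El by (auto intro!: exI[of _ "\<lambda>_. 0"])
  next
    case (step k)
    then show ?case using iff by auto
  qed
  have "\<not> exact_at V (insert Z (E (Suc p))) (Suc (card Z))"
  proof (rule critical_cell_not_exact)
    show "Z \<subseteq> V" using EV[of p] p by auto
    show "F \<in> E (Suc p)" if "F \<subset> Z" for F using down[of p Z F] that p by auto
    show "G \<in> E (Suc p)" if "F \<in> E (Suc p)" "G \<subseteq> F" for F G
      using down that p by (meson Suc_leI)
    show "exact_at V (E (Suc p)) (card Z)" using top p by auto
  qed (use fin p in auto)
  then have at_p: "\<not> exact_at V (E p) (Suc (card Z))" using p by simp
  have "\<not> exact_at V (E k) (Suc (card Z))" if "k \<le> p" for k
    using that at_p
  proof (induction k rule: inc_induct)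
    case (step k)
    then show ?case using iff[of k] p(1) by simp
  qed
  then show ?thesis by blast
qed

section \<open>Boolean permutations\<close>

text \<open>Only \<open>sigma k\<close> moves a value across the cut between \<open>k\<close> and
  \<open>Suc k\<close>.\<close>

lemma word_perm_le_iff: "k \<notin> set u \<Longrightarrow> word_perm u x \<le> k \<longleftrightarrow> x \<le> k"
  by (induction u) (auto simp: sigma_apply split: if_splits)

text \<open>For a word with distinct letters this recovers its letter set from the permutation
  alone.\<close>

definition crossings :: "(nat \<Rightarrow> nat) \<Rightarrow> nat set" where
  "crossings p = {k. \<exists>x\<le>k. p x > k}"

lemma crossings_subset: "crossings (word_perm u) \<subseteq> set u"
proof
  fix k assume "k \<in> crossings (word_perm u)"
  then show "k \<in> set u" using word_perm_le_iff[of k u] by (auto simp: crossings_def not_le[symmetric])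
qed

lemma crossings_distinct:
  assumes "distinct u"
  shows "crossings (word_perm u) = set u"
proof -
  have "\<exists>x\<le>k. word_perm u x > k" if "k \<in> set u" for k
  proof -
    obtain \<alpha> \<beta> where u: "u = \<alpha> @ k # \<beta>" using \<open>k \<in> set u\<close> by (meson split_list)
    obtain x where x: "word_perm \<beta> x = k" using word_perm_surj .
    have "x \<le> k" using word_perm_le_iff[of k \<beta> x] u assms x by auto
    moreover have "\<not> word_perm \<alpha> (Suc k) \<le> k"
      using word_perm_le_iff[of k \<alpha> "Suc k"] u assms by auto
    ultimately show ?thesis using x by (intro exI[of _ x]) (auto simp: u sigma_apply)
  qed
  then show ?thesis using crossings_subset by (fastforce simp: crossings_def)
qed

text \<open>Any word for the same permutation contains all crossings, hence all letters of
  \<open>u\<close>.\<close>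

lemma distinct_reduced:
  assumes "distinct u" "is_word n u"
  shows "reduced n u"
proof -
  obtain w where w: "reduced n w" "word_perm w = word_perm u"
    using reduced_word word_perm_permutes assms by metis
  have "set u \<subseteq> set w" using crossings_distinct[OF assms(1)] crossings_subset[of w] w by simp
  then have "length u \<le> length w"
    using assms by (metis List.finite_set card_length card_mono distinct_card le_trans)
  then show ?thesis using assms len_le w by (metis le_antisym reduced_def)
qed

section \<open>The order of neighbouring letters in a word\<close>

definition adj :: "nat \<Rightarrow> nat list \<Rightarrow> nat list" where
  "adj k u = filter (\<lambda>x. x = k \<or> x = Suc k) u"

lemma adj_append [simp]: "adj k (u @ w) = adj k u @ adj k w"
  by (simp add: adj_def)

lemma adj_rev: "adj k (rev u) = rev (adj k u)"
  by (simp add: adj_def rev_filter)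

lemma adj_filter:
  "k \<in> F \<Longrightarrow> Suc k \<in> F \<Longrightarrow> adj k (filter (\<lambda>x. x \<in> F) u) = adj k u"
  by (auto simp: adj_def intro!: filter_cong)

lemma adj_distinct:
  "distinct u \<Longrightarrow> k \<notin> set u \<or> Suc k \<notin> set u \<Longrightarrow>
     adj k u = (if k \<in> set u then [k] else if Suc k \<in> set u then [Suc k] else [])"
  unfolding adj_def by (induction u) auto

lemma adj_cases:
  assumes "distinct u" "k \<in> set u" "Suc k \<in> set u"
  obtains \<alpha> \<beta> where "u = \<alpha> @ k # \<beta>" "Suc k \<in> set \<beta>" "adj k u = [k, Suc k]"
  | \<alpha> \<beta> where "u = \<alpha> @ k # \<beta>" "Suc k \<in> set \<alpha>" "adj k u = [Suc k, k]"
proof -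
  obtain \<alpha> \<beta> where u: "u = \<alpha> @ k # \<beta>" using assms by (meson split_list)
  have "adj k u = adj k \<alpha> @ [k] @ adj k \<beta>" by (simp add: u adj_def)
  moreover have "adj k \<alpha> = (if Suc k \<in> set \<alpha> then [Suc k] else [])"
    "adj k \<beta> = (if Suc k \<in> set \<beta> then [Suc k] else [])"
    using assms u adj_distinct[of \<alpha> k] adj_distinct[of \<beta> k] by auto
  moreover have "Suc k \<in> set \<alpha> \<and> Suc k \<notin> set \<beta> \<or> Suc k \<in> set \<beta> \<and> Suc k \<notin> set \<alpha>"
    using assms u by auto
  ultimately show ?thesis using u that by (metis append_Cons append_Nil append_Nil2)
qed

text \<open>Makes the order of \<open>k\<close> and \<open>Suc k\<close> visible in the permutation,
  so that all words with distinct letters for one permutation agree on it.\<close>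

lemma adj_word_perm:
  assumes "distinct u" "k \<in> set u" "Suc k \<in> set u"
  shows "adj k u = [k, Suc k] \<longleftrightarrow> (\<exists>x\<le>k. word_perm u x = Suc k)"
  using assms
proof (cases rule: adj_cases)
  case (1 \<alpha> \<beta>)
  have "k \<in> crossings (word_perm (\<alpha> @ [k]))" 
    by (subst crossings_distinct) (use 1 assms in auto)
  then obtain y where y: "y \<le> k" "word_perm (\<alpha> @ [k]) y > k" by (auto simp: crossings_def)
  have "word_perm (\<alpha> @ [k]) y \<le> Suc k"
    using word_perm_le_iff[of "Suc k" "\<alpha> @ [k]" y] 1 assms y by auto
  then have "word_perm (\<alpha> @ [k]) y = Suc k" using y by linarith
  moreover obtain x where "word_perm \<beta> x = y" using word_perm_surj .
  moreover have "x \<le> k" using word_perm_le_iff[of k \<beta> x] calculation 1 assms y by auto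
  ultimately show ?thesis using 1 by auto
next
  case (2 \<alpha> \<beta>)
  have False if x: "x \<le> k" "word_perm u x = Suc k" for x
  proof -
    let ?y = "word_perm (k # \<beta>) x"
    have "?y \<le> Suc k" using word_perm_le_iff[of "Suc k" "k # \<beta>" x] 2 assms x by auto
    moreover have ay: "word_perm \<alpha> ?y = Suc k" using x 2 by simp
    then have "\<not> ?y \<le> k" using word_perm_le_iff[of k \<alpha> ?y] 2 assms by auto
    ultimately have fixed: "word_perm \<alpha> (Suc k) = Suc k" using ay by (metis le_SucE)
    have "Suc k \<in> crossings (word_perm \<alpha>)" using crossings_distinct 2 assms by auto
    then obtain z where z: "z \<le> Suc k" "word_perm \<alpha> z > Suc k" by (auto simp: crossings_def)
    then have "z \<le> k" using fixed by (metis le_SucE less_irrefl)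
    then show False using word_perm_le_iff[of k \<alpha> z] 2 assms z by auto
  qed
  then show ?thesis using 2 by auto
qed

lemma sigma_commute: "\<forall>x\<in>set u. Suc x < a \<Longrightarrow> word_perm u \<circ> sigma a = sigma a \<circ> word_perm u"
proof (induction u)
  case (Cons k u)
  have "sigma k \<circ> sigma a = sigma a \<circ> sigma k" using Cons.prems by (auto simp: fun_eq_iff sigma_apply)
  moreover have "word_perm u \<circ> sigma a = sigma a \<circ> word_perm u"
    using Cons.prems by (intro Cons.IH) simp
  ultimately show ?case by (metis comp_assoc word_perm_Cons)
qed (simp add: fun_eq_iff)

text \<open>The largest letter commutes with every letter except \<open>b\<close>, so it can be
  moved to the end of the word on its own side of \<open>b\<close>.\<close>

lemma word_perm_remove_max:
  assumes "distinct u" "Suc b \<in> set u" "\<forall>x\<in>set u. x \<le> Suc b"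
  shows "word_perm u = (let p = word_perm (filter (\<lambda>x. x \<noteq> Suc b) u) in
    if adj b u = [b, Suc b] then p \<circ> sigma (Suc b) else sigma (Suc b) \<circ> p)"
proof -
  obtain \<alpha> \<beta> where u: "u = \<alpha> @ Suc b # \<beta>" using assms by (meson split_list)
  have f: "filter (\<lambda>x. x \<noteq> Suc b) u = \<alpha> @ \<beta>"
    using assms u by (auto simp: filter_id_conv intro!: arg_cong2[of _ _ _ _ append])
  have lt: "x < Suc b" if "x \<in> set \<alpha> \<union> set \<beta>" for x
    using that assms u by (metis UnE Un_iff distinct_append distinct.simps(2) disjoint_iff le_neq_implies_less list.set_intros(1,2) set_append)
  have adj: "adj b u = adj b \<alpha> @ [Suc b] @ adj b \<beta>" by (simp add: u adj_def)
  show ?thesis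
  proof (cases "b \<in> set \<alpha>")
    case True
    then have "b \<notin> set \<beta>" using assms u by auto
    then have "\<forall>x\<in>set \<beta>. Suc x < Suc b" using lt by (metis UnCI less_antisym Suc_less_eq)
    then have "word_perm \<beta> \<circ> sigma (Suc b) = sigma (Suc b) \<circ> word_perm \<beta>" by (rule sigma_commute)
    moreover have "adj b u = [b, Suc b]"
      using adj adj_distinct[of \<alpha> b] adj_distinct[of \<beta> b] True assms u by auto
    ultimately show ?thesis unfolding f by (simp add: u comp_assoc)
  next
    case False
    then have "\<forall>x\<in>set \<alpha>. Suc x < Suc b" using lt by (metis UnCI less_antisym Suc_less_eq)
    then have "word_perm \<alpha> \<circ> sigma (Suc b) = sigma (Suc b) \<circ> word_perm \<alpha>" by (rule sigma_commute)
    moreover have "adj b u \<noteq> [b, Suc b]"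
      using adj adj_distinct[of \<alpha> b] False assms u by auto
    ultimately show ?thesis unfolding f by (simp add: u comp_assoc[symmetric])
  qed
qed

text \<open>Letters that are not neighbours commute, so the order of neighbouring letters determines
  the permutation; the induction strips the largest letter.\<close>

lemma word_perm_eqI:
  assumes "distinct u" "distinct w" "set u = set w" "0 \<notin> set u"
    "\<And>k. k \<in> set u \<Longrightarrow> Suc k \<in> set u \<Longrightarrow> adj k u = adj k w"
  shows "word_perm u = word_perm w"
  using assms
proof (induction "length u" arbitrary: u w rule: less_induct)
  case less
  show ?case
  proof (cases "u = []")
    case True
    then show ?thesis using less by simp
  next
    case False
    have "Max (set u) \<in> set u" using False by simp
    then obtain b where b: "Max (set u) = Suc b" using less.prems(4) by (metis not0_implies_Suc)
    have bu: "Suc b \<in> set u" "\<forall>x\<in>set u. x \<le> Suc b"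
      using False b Max_in[of "set u"] Max_ge[of "set u"] by auto
    let ?f = "filter (\<lambda>x. x \<noteq> Suc b)"
    have "length (?f u) < length u" using bu by (intro length_filter_less) auto
    moreover have "adj k (?f u) = adj k (?f w)" if "k \<in> set (?f u)" "Suc k \<in> set (?f u)" for k
    proof -
      have "adj k (filter (\<lambda>x. x \<in> - {Suc b}) u) = adj k (filter (\<lambda>x. x \<in> - {Suc b}) w)"
        using that less.prems(5)[of k] by (subst (1 2) adj_filter) auto
      then show ?thesis by simp
    qed
    ultimately have IH: "word_perm (?f u) = word_perm (?f w)"
      using less.prems by (intro less.hyps) auto
    have "adj b u = [b, Suc b] \<longleftrightarrow> adj b w = [b, Suc b]"
    proof (cases "b \<in> set u")
      case True
      then show ?thesis using less.prems(5)[of b] bu by simp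
    next
      case False
      then show ?thesis using adj_distinct[of u b] adj_distinct[of w b] less.prems by auto
    qed
    then show ?thesis
      using word_perm_remove_max[of u b] word_perm_remove_max[of w b] bu IH less.prems
      by (simp add: Let_def)
  qed
qed

lemma subseq_distinct_filter:
  "subseq u w \<Longrightarrow> distinct w \<Longrightarrow> u = filter (\<lambda>x. x \<in> set u) w"
proof (induction rule: list_emb.induct)
  case (list_emb_Nil ys)
  then show ?case by simp
next
  case (list_emb_Cons xs ys y)
  then have "y \<notin> set xs" using subseq_set by fastforce
  then show ?case using list_emb_Cons by simp
next
  case (list_emb_Cons2 x y xs ys)
  then have "filter (\<lambda>z. z \<in> set (x # xs)) ys = filter (\<lambda>z. z \<in> set xs) ys"
    by (intro filter_cong) auto
  then show ?case using list_emb_Cons2 by simp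
qed

lemma adj_upt: "c \<le> k \<Longrightarrow> k < a \<Longrightarrow> adj k [c..<Suc a] = [k, Suc k]"
proof -
  assume "c \<le> k" "k < a"
  then have "[c..<Suc a] = [c..<k] @ [k, Suc k] @ [Suc (Suc k)..<Suc a]"
    by (metis append_Cons append_Nil le_SucI less_Suc_eq_le less_imp_le_nat upt_add_eq_append upt_conv_Cons le_Suc_ex Suc_leI)
  then show ?thesis by (auto simp: adj_def filter_empty_conv)
qed

lemma is_run_upt: "c \<le> a \<Longrightarrow> is_run [c..<Suc a]" "c \<le> a \<Longrightarrow> is_run (rev [c..<Suc a])"
  by (auto simp: is_run_def hd_conv_nth rev_nth simp del: upt_Suc)

section \<open>The ideal below a word with distinct letters\<close>

locale boolean_word =
  fixes n :: nat and s :: "nat list"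
  assumes word: "is_word n s" and dist: "distinct s"
begin

definition sub :: "nat set \<Rightarrow> nat \<Rightarrow> nat" where
  "sub F = word_perm (filter (\<lambda>x. x \<in> F) s)"

lemma word_filter: "is_word n (filter (\<lambda>x. x \<in> F) s)"
  using word by (auto simp: is_word_def)

lemma sub_word_perm:
  assumes "distinct u" "set u = F" "F \<subseteq> set s"
    and "\<And>k. k \<in> F \<Longrightarrow> Suc k \<in> F \<Longrightarrow> adj k u = adj k s"
  shows "word_perm u = sub F"
  unfolding sub_def
proof (rule word_perm_eqI)
  show "0 \<notin> set u" using word assms by (auto simp: is_word_def)
qed (use assms dist in \<open>auto simp: adj_filter\<close>)

lemma crossings_sub: "F \<subseteq> set s \<Longrightarrow> crossings (sub F) = F"
  unfolding sub_def using crossings_distinct[of "filter (\<lambda>x. x \<in> F) s"] dist by auto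

lemma inj_sub: "inj_on sub (Pow (set s))"
  by (rule inj_on_inverseI[of _ crossings]) (simp add: crossings_sub)

lemma len_sub:
  assumes "F \<subseteq> set s"
  shows "len n (sub F) = card F"
proof -
  have "length (filter (\<lambda>x. x \<in> F) s) = card F"
    using assms dist distinct_card[of "filter (\<lambda>x. x \<in> F) s"]
    by (simp add: inf.absorb2 Collect_conj_eq[symmetric] Int_def[symmetric] Int_absorb1)
  then show ?thesis
    using distinct_reduced[OF _ word_filter, of F] dist unfolding reduced_def sub_def by simp
qed

lemma sub_mono:
  assumes "F \<subseteq> G"
  shows "bruhat_le n (sub F) (sub G)"
proof -
  have "filter (\<lambda>x. x \<in> F) s = filter (\<lambda>x. x \<in> F) (filter (\<lambda>x. x \<in> G) s)"
    using assms by (auto intro!: filter_cong)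
  then have "subseq (filter (\<lambda>x. x \<in> F) s) (filter (\<lambda>x. x \<in> G) s)" by (metis subseq_filter_left)
  then show ?thesis unfolding sub_def
    using subseq_bruhat_le reduced_ascending distinct_reduced word_filter dist distinct_filter by blast
qed

lemma sub_le_iff:
  assumes "F \<subseteq> set s" "G \<subseteq> set s"
  shows "bruhat_le n (sub F) (sub G) \<longleftrightarrow> F \<subseteq> G"
proof
  assume "bruhat_le n (sub F) (sub G)"
  then obtain u where u: "subseq u (filter (\<lambda>x. x \<in> G) s)" "word_perm u = sub F"
    using bruhat_le_subseq unfolding sub_def by metis
  then have "F \<subseteq> set u" using crossings_subset[of u] crossings_sub assms by simp
  then show "F \<subseteq> G" using subseq_set[OF u(1)] by auto
qed (rule sub_mono)

lemma sub_all: "sub (set s) = word_perm s"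
  unfolding sub_def by (metis filter_True)

lemma bideal_eq: "bideal n (word_perm s) = sub ` Pow (set s)"
proof
  show "bideal n (word_perm s) \<subseteq> sub ` Pow (set s)"
  proof
    fix u assume "u \<in> bideal n (word_perm s)"
    then obtain w where "subseq w s" "word_perm w = u"
      unfolding bideal_def using bruhat_le_subseq by blast
    then show "u \<in> sub ` Pow (set s)"
      using subseq_distinct_filter[OF _ dist, of w] subseq_set[of w s] unfolding sub_def
      by (intro image_eqI[of _ _ "set w"]) auto
  qed
  show "sub ` Pow (set s) \<subseteq> bideal n (word_perm s)"
    using sub_mono by (auto simp: bideal_def sub_all[symmetric])
qed

text \<open>A reduced word of \<open>sub F\<close> has \<open>card F\<close> letters and contains
  every crossing, so each letter of \<open>F\<close> appears once; \<open>adj_word_perm\<close> then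
  fixes the order of neighbours.\<close>

lemma sub_ascending_word:
  assumes "ascending_word u" "is_word n u" "word_perm u = sub F" "F \<subseteq> set s"
  shows "distinct u" "set u = F"
    "\<And>k. k \<in> F \<Longrightarrow> Suc k \<in> F \<Longrightarrow> adj k u = adj k s"
proof -
  have "F \<subseteq> set u" using crossings_subset[of u] crossings_sub assms by simp
  moreover have "length u = card F"
    using ascending_reduced[OF assms(1,2)] len_sub assms by (simp add: reduced_def)
  ultimately show u: "distinct u" "set u = F"
    by (metis List.finite_set card_distinct card_length card_mono card_seteq le_antisym)+
  fix k assume k: "k \<in> F" "Suc k \<in> F"
  let ?w = "filter (\<lambda>x. x \<in> F) s"
  have w: "distinct ?w" "set ?w = F" "word_perm ?w = word_perm u" "adj k ?w = adj k s"
    using dist assms k by (auto simp: sub_def adj_filter)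
  have "adj k u = [k, Suc k] \<longleftrightarrow> adj k ?w = [k, Suc k]"
    using adj_word_perm[OF u(1), of k] adj_word_perm[OF w(1), of k] u(2) w(2,3) k by auto
  moreover have "adj k u = [k, Suc k] \<or> adj k u = [Suc k, k]"
    using adj_cases[of u k] u k by metis
  moreover have "adj k ?w = [k, Suc k] \<or> adj k ?w = [Suc k, k]"
    using adj_cases[of ?w k] w k by metis
  ultimately show "adj k u = adj k s" using w by auto
qed

definition faces :: "(nat \<Rightarrow> nat) \<Rightarrow> nat set set" where
  "faces w = {F. F \<subseteq> set s \<and> bruhat_le n (sub F) w}"

lemma bideal_Int_eq: "bideal n (word_perm s) \<inter> bideal n w = sub ` faces w"
  unfolding bideal_eq by (auto simp: faces_def bideal_def)

lemma faces_down: "F \<in> faces w \<Longrightarrow> G \<subseteq> F \<Longrightarrow> G \<in> faces w"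
  unfolding faces_def using sub_mono bruhat_le_trans by blast

abbreviation asc :: "nat \<Rightarrow> bool" where
  "asc k \<equiv> adj k s = [k, Suc k]"

lemma not_asc: "k \<in> set s \<Longrightarrow> Suc k \<in> set s \<Longrightarrow> \<not> asc k \<longleftrightarrow> adj k s = [Suc k, k]"
  using adj_cases[OF dist, of k] by (metis list.inject n_not_Suc_n)

text \<open>Within the letters of \<open>s\<close>, \<open>\<not> asc k\<close> says that
  \<open>Suc k\<close> precedes \<open>k\<close> (\<open>not_asc\<close>), so the second alternative
  describes a decreasing stretch. Single letters count, with \<open>c = a\<close>.\<close>

definition monotone_interval :: "nat set \<Rightarrow> bool" where
  "monotone_interval N \<longleftrightarrow> N \<subseteq> set s \<and> (\<exists>c a. c \<le> a \<and> N = {c..a} \<and>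
     ((\<forall>k. c \<le> k \<and> k < a \<longrightarrow> asc k) \<or> (\<forall>k. c \<le> k \<and> k < a \<longrightarrow> \<not> asc k)))"

text \<open>Only neighbouring letters are constrained, because their order alone determines the
  permutation (\<open>word_perm_eqI\<close>); this freedom is what allows gluing.\<close>

definition occurs :: "nat list \<Rightarrow> nat set \<Rightarrow> bool" where
  "occurs w F \<longleftrightarrow> (\<exists>pos. (\<forall>i\<in>F. pos i < length w \<and> w ! pos i = i) \<and>
     (\<forall>k. k \<in> F \<and> Suc k \<in> F \<longrightarrow> (pos k < pos (Suc k) \<longleftrightarrow> asc k)))"

end

lemma adj_nths:
  assumes "distinct (nths w P)" "p < q" "q < length w" "p \<in> P" "q \<in> P"
    and "{w ! p, w ! q} = {k, Suc k}"
  shows "adj k (nths w P) = [w ! p, w ! q]"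
proof -
  let ?P' = "{i. i + q \<in> P}"
  have "nths (take q w @ drop q w) P = nths (take q w) P @ nths (drop q w) ?P'"
    using assms(3) by (simp only: nths_append length_take min_absorb2 less_imp_le)
  then have split: "nths w P = nths (take q w) P @ nths (drop q w) ?P'" by simp
  have "w ! p \<in> set (nths (take q w) P)" using assms by (auto simp: set_nths intro!: exI[of _ p])
  moreover have "w ! q \<in> set (nths (drop q w) ?P')"
    using assms by (auto simp: set_nths intro!: exI[of _ 0])
  moreover have "distinct (nths (take q w) P)" "distinct (nths (drop q w) ?P')"
    "set (nths (take q w) P) \<inter> set (nths (drop q w) ?P') = {}"
    using assms(1) unfolding split by simp_all
  ultimately have "w ! q \<notin> set (nths (take q w) P)" "w ! p \<notin> set (nths (drop q w) ?P')"
    and d: "distinct (nths (take q w) P)" "distinct (nths (drop q w) ?P')"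
    and m: "w ! p \<in> set (nths (take q w) P)" "w ! q \<in> set (nths (drop q w) ?P')"
    by blast+
  then show ?thesis
    using assms(6) adj_distinct[OF d(1), of k] adj_distinct[OF d(2), of k]
    unfolding split adj_append doubleton_eq_iff by auto
qed

section \<open>Faces, monotone intervals and run covers\<close>

context boolean_word
begin

lemma occursE:
  assumes "occurs w F"
  obtains pos where "\<And>i. i \<in> F \<Longrightarrow> pos i < length w \<and> w ! pos i = i"
    "\<And>k. k \<in> F \<Longrightarrow> Suc k \<in> F \<Longrightarrow> pos k < pos (Suc k) \<longleftrightarrow> asc k"
  using assms unfolding occurs_def by blast

text \<open>Turns a Bruhat comparison into a choice of positions. In the forward direction the
  subword is first made reduced, so that its letters are exactly \<open>F\<close> and neighbours
  stand as in \<open>s\<close>.\<close>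

lemma le_iff_occurs:
  assumes "reduced n w" "F \<subseteq> set s"
  shows "bruhat_le n (sub F) (word_perm w) \<longleftrightarrow> occurs w F"
proof
  assume "bruhat_le n (sub F) (word_perm w)"
  then obtain u0 where u0: "subseq u0 w" "word_perm u0 = sub F" using bruhat_le_subseq by blast
  obtain u where u: "subseq u u0" "ascending_word u" "word_perm u = sub F"
    using reduced_subseq[of u0] u0 by metis
  have uw: "subseq u w" using u u0 subseq_order.order_trans by blast
  then have "is_word n u" using assms is_word_subseq reduced_def by blast
  note d = sub_ascending_word[OF u(2) this u(3) assms(2)]
  obtain P where P: "u = nths w P" using uw by (auto simp: subseq_conv_nths)
  have "\<forall>i\<in>F. \<exists>p. p < length w \<and> p \<in> P \<and> w ! p = i"
    using d(2) by (auto simp: P set_nths)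
  then obtain pos where pos: "\<And>i. i \<in> F \<Longrightarrow> pos i < length w \<and> pos i \<in> P \<and> w ! pos i = i"
    by metis
  have "pos k < pos (Suc k) \<longleftrightarrow> asc k" if k: "k \<in> F" "Suc k \<in> F" for k
  proof -
    have "pos k \<noteq> pos (Suc k)" using pos k by (metis n_not_Suc_n)
    then consider "pos k < pos (Suc k)" | "pos (Suc k) < pos k" by linarith
    then show ?thesis
    proof cases
      case 1
      then show ?thesis using adj_nths[of w P "pos k" "pos (Suc k)" k] pos k d P by auto
    next
      case 2
      then have "adj k u = [Suc k, k]"
        using adj_nths[of w P "pos (Suc k)" "pos k" k] pos k d P by auto
      then show ?thesis using 2 d(3)[OF k] by auto
    qed
  qed
  then show "occurs w F" unfolding occurs_def using pos by blast
next
  assume "occurs w F"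
  then obtain pos where pos: "\<And>i. i \<in> F \<Longrightarrow> pos i < length w \<and> w ! pos i = i"
    "\<And>k. k \<in> F \<Longrightarrow> Suc k \<in> F \<Longrightarrow> pos k < pos (Suc k) \<longleftrightarrow> asc k"
    unfolding occurs_def by blast
  let ?P = "pos ` F"
  let ?u = "nths w ?P"
  have "finite F" using assms finite_subset by blast
  have set_u: "set ?u = F" using pos(1) by (force simp: set_nths)
  have "inj_on pos F" using pos(1) by (metis inj_onI)
  then have "card ?P = card F" by (rule card_image)
  moreover have "{i. i < length w \<and> i \<in> ?P} = ?P" using pos(1) by auto
  ultimately have "length ?u = card F" by (simp add: length_nths)
  then have d: "distinct ?u" using set_u by (simp add: card_distinct)
  have "adj k ?u = adj k s" if k: "k \<in> F" "Suc k \<in> F" for k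
  proof (cases "pos k < pos (Suc k)")
    case True
    then show ?thesis using adj_nths[OF d True] pos k by auto
  next
    case False
    then have "pos (Suc k) < pos k" using pos k by (metis linorder_neqE_nat n_not_Suc_n)
    then have "adj k ?u = [Suc k, k]" using adj_nths[OF d, of "pos (Suc k)" "pos k" k] pos k by auto
    then show ?thesis using False pos(2)[OF k] not_asc[of k] k assms(2) by (metis subsetD)
  qed
  then have "word_perm ?u = sub F" using d set_u assms by (intro sub_word_perm)
  moreover have "subseq ?u w" by (auto simp: subseq_conv_nths)
  ultimately show "bruhat_le n (sub F) (word_perm w)"
    using subseq_bruhat_le reduced_ascending assms reduced_def by metis
qed

text \<open>Across a gap nothing relates the two sides. At a change of direction the letter
  \<open>i\<close> lies before both neighbours or after both, so occurrences that share only
  \<open>i\<close> can be merged. A nonempty \<open>F\<close> with neither is itself a monotone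
  interval.\<close>

lemma occurs_if_intervals:
  assumes "F \<subseteq> set s" "\<And>N. N \<subseteq> F \<Longrightarrow> monotone_interval N \<Longrightarrow> occurs w N"
  shows "occurs w F"
proof -
  have "finite F" using assms finite_subset by blast
  then show ?thesis using assms
  proof (induction F rule: finite_psubset_induct)
    case (psubset F)
    have IH: "occurs w G" if "G \<subset> F" for G
      using psubset.IH[OF that] psubset.prems that by blast
    show ?case
    proof (cases "F = {}")
      case True
      then show ?thesis by (simp add: occurs_def)
    next
      case False
      define c where "c = Min F"
      define a where "a = Max F"
      have ca: "c \<in> F" "a \<in> F" "\<And>x. x \<in> F \<Longrightarrow> c \<le> x \<and> x \<le> a"
        using False psubset.hyps by (auto simp: c_def a_def)
      show ?thesis
      proof (cases "F = {c..a}")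
        case no_gap: False
        then obtain g where g: "g \<notin> F" "c \<le> g" "g \<le> a" using ca by (metis atLeastAtMost_iff subsetI subset_antisym)
        then have g': "c < g" "g < a" using ca by (metis le_neq_implies_less)+
        have "a \<notin> {x\<in>F. x < g}" "c \<notin> {x\<in>F. g < x}" using g' by auto
        then have "{x\<in>F. x < g} \<subset> F" "{x\<in>F. g < x} \<subset> F" using ca(1,2) by blast+
        then have occ: "occurs w {x\<in>F. x < g}" "occurs w {x\<in>F. g < x}" using IH by blast+
        from occ(1) obtain pos1 where
          pos1: "\<And>i. i \<in> {x\<in>F. x < g} \<Longrightarrow> pos1 i < length w \<and> w ! pos1 i = i"
            "\<And>k. k \<in> {x\<in>F. x < g} \<Longrightarrow> Suc k \<in> {x\<in>F. x < g} \<Longrightarrow> pos1 k < pos1 (Suc k) \<longleftrightarrow> asc k"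
          by (rule occursE) blast
        from occ(2) obtain pos2 where
          pos2: "\<And>i. i \<in> {x\<in>F. g < x} \<Longrightarrow> pos2 i < length w \<and> w ! pos2 i = i"
            "\<And>k. k \<in> {x\<in>F. g < x} \<Longrightarrow> Suc k \<in> {x\<in>F. g < x} \<Longrightarrow> pos2 k < pos2 (Suc k) \<longleftrightarrow> asc k"
          by (rule occursE) blast
        let ?pos = "\<lambda>i. if i < g then pos1 i else pos2 i"
        have "?pos i < length w \<and> w ! ?pos i = i" if "i \<in> F" for i
          using that g pos1(1)[of i] pos2(1)[of i] by (cases i g rule: linorder_cases) auto
        moreover have "?pos k < ?pos (Suc k) \<longleftrightarrow> asc k" if "k \<in> F" "Suc k \<in> F" for k
        proof -
          have "k \<noteq> g" "Suc k \<noteq> g" using that g by auto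
          then consider "Suc k < g" | "g < k" by linarith
          then show ?thesis using that pos1(2)[of k] pos2(2)[of k] by cases auto
        qed
        ultimately show ?thesis unfolding occurs_def by (intro exI[of _ ?pos]) simp
      next
        case F: True
        show ?thesis
        proof (cases "monotone_interval F")
          case True
          then show ?thesis using psubset.prems by blast
        next
          case False
          have "\<exists>i. c < i \<and> i < a \<and> asc (i - 1) \<noteq> asc i"
          proof (rule ccontr)
            assume no: "\<not> ?thesis"
            have "asc k \<longleftrightarrow> asc c" if "c \<le> k" "k < a" for k
              using that
            proof (induction k rule: dec_induct)
              case (step k)
              then show ?case using no by (metis Suc_lessD diff_Suc_1 le_imp_less_Suc)
            qed simp
            then have "(\<forall>k. c \<le> k \<and> k < a \<longrightarrow> asc k) \<or> (\<forall>k. c \<le> k \<and> k < a \<longrightarrow> \<not> asc k)"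
              by (cases "asc c") simp_all
            moreover have "c \<le> a" using ca by blast
            ultimately have "monotone_interval F"
              unfolding monotone_interval_def using F psubset.prems(1)
              by (intro conjI exI[of _ c] exI[of _ a])
            then show False using False by blast
          qed
          then obtain i where i: "c < i" "i < a" "asc (i - 1) \<noteq> asc i" by blast
          have "{c..i} \<subset> F" "{i..a} \<subset> F" using i F by auto
          then have occ: "occurs w {c..i}" "occurs w {i..a}" using IH by blast+
          from occ(1) obtain pos1 where
            pos1: "\<And>j. j \<in> {c..i} \<Longrightarrow> pos1 j < length w \<and> w ! pos1 j = j"
              "\<And>k. k \<in> {c..i} \<Longrightarrow> Suc k \<in> {c..i} \<Longrightarrow> pos1 k < pos1 (Suc k) \<longleftrightarrow> asc k"
            by (rule occursE) blast
          from occ(2) obtain pos2 where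
            pos2: "\<And>j. j \<in> {i..a} \<Longrightarrow> pos2 j < length w \<and> w ! pos2 j = j"
              "\<And>k. k \<in> {i..a} \<Longrightarrow> Suc k \<in> {i..a} \<Longrightarrow> pos2 k < pos2 (Suc k) \<longleftrightarrow> asc k"
            by (rule occursE) blast
          \<comment> \<open>If \<open>asc i\<close> holds and \<open>asc (i - 1)\<close> fails,
            \<open>i\<close> must precede both neighbours, so the earlier position serves both
            sides; the opposite change calls for the later one.\<close>
          define q where "q = (if asc i then min (pos1 i) (pos2 i) else max (pos1 i) (pos2 i))"
          let ?pos = "\<lambda>j. if j < i then pos1 j else if j = i then q else pos2 j"
          have "?pos j < length w \<and> w ! ?pos j = j" if "j \<in> F" for j
            using that F i pos1(1)[of j] pos2(1)[of j]
            by (cases j i rule: linorder_cases) (auto simp: q_def min_def max_def)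
          moreover have "?pos k < ?pos (Suc k) \<longleftrightarrow> asc k" if "k \<in> F" "Suc k \<in> F" for k
          proof -
            consider "Suc k < i" | "Suc k = i" | "k = i" | "i < k" by linarith
            then show ?thesis
            proof cases
              case 1
              then show ?thesis using that F pos1(2)[of k] by auto
            next
              case 2
              then show ?thesis using that F pos1(2)[of k] i by (auto simp: q_def)
            next
              case 3
              then show ?thesis using that F pos2(2)[of k] i by (auto simp: q_def)
            next
              case 4
              then show ?thesis using that F pos2(2)[of k] by auto
            qed
          qed
          ultimately show ?thesis unfolding occurs_def by (intro exI[of _ ?pos]) simp
        qed
      qed
    qed
  qed
qed

lemma faces_eq:
  assumes "w permutes {1..n}"
  shows "faces w = {F. F \<subseteq> set s \<and> (\<forall>N. monotone_interval N \<and> N \<notin> faces w \<longrightarrow> \<not> N \<subseteq> F)}"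
proof -
  obtain \<omega> where \<omega>: "reduced n \<omega>" "word_perm \<omega> = w" using reduced_word assms by blast
  have occ: "F \<in> faces w \<longleftrightarrow> F \<subseteq> set s \<and> occurs \<omega> F" for F
    unfolding faces_def using le_iff_occurs[OF \<omega>(1)] \<omega>(2) by blast
  show ?thesis
  proof (intro set_eqI iffI)
    fix F assume F: "F \<in> faces w"
    have "\<not> N \<subseteq> F" if "monotone_interval N \<and> N \<notin> faces w" for N
      using that faces_down[OF F, of N] by auto
    then show "F \<in> {F. F \<subseteq> set s \<and> (\<forall>N. monotone_interval N \<and> N \<notin> faces w \<longrightarrow> \<not> N \<subseteq> F)}"
      using F occ by simp
  next
    fix F assume F: "F \<in> {F. F \<subseteq> set s \<and> (\<forall>N. monotone_interval N \<and> N \<notin> faces w \<longrightarrow> \<not> N \<subseteq> F)}"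
    then have "occurs \<omega> N" if "N \<subseteq> F" "monotone_interval N" for N
      using that occ[of N] by auto
    then show "F \<in> faces w" using occurs_if_intervals[of F \<omega>] occ[of F] F by simp
  qed
qed

text \<open>Works downward from the largest letter: an interval through it is cut back to end there,
  and the letters below its lower end \<open>c\<close> are covered by the other intervals. The bound
  \<open>b\<close> is there for this recursion.\<close>

lemma runs_from_cover:
  assumes "finite \<C>" "\<forall>N\<in>\<C>. monotone_interval N" "{x\<in>set s. x < b} \<subseteq> \<Union>\<C>"
  shows "\<exists>rs. length rs \<le> card \<C> \<and> (\<forall>r\<in>set rs. is_run r) \<and> distinct (concat rs)
    \<and> set (concat rs) = {x\<in>set s. x < b}
    \<and> (\<forall>k. k \<in> set s \<and> Suc k \<in> set s \<and> Suc k < b \<longrightarrow> adj k (concat rs) = adj k s)"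
  using assms
proof (induction "card \<C>" arbitrary: \<C> b rule: less_induct)
  case less
  let ?W = "{x\<in>set s. x < b}"
  show ?case
  proof (cases "?W = {}")
    case True
    have "\<not> (Suc k \<in> set s \<and> Suc k < b)" for k using True by blast
    then show ?thesis using True by (intro exI[of _ "[]"]) auto
  next
    case False
    define a where "a = Max ?W"
    have a: "a \<in> ?W" "\<And>x. x \<in> ?W \<Longrightarrow> x \<le> a"
      using False Max_in[of ?W] Max_ge[of ?W] by (auto simp: a_def)
    then obtain N where N: "N \<in> \<C>" "a \<in> N" using less.prems by blast
    then have "monotone_interval N" using less.prems(2) by blast
    then obtain c a' where ca: "N = {c..a'}" "N \<subseteq> set s"
      "(\<forall>k. c \<le> k \<and> k < a' \<longrightarrow> asc k) \<or> (\<forall>k. c \<le> k \<and> k < a' \<longrightarrow> \<not> asc k)"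
      unfolding monotone_interval_def by blast
    have "c \<le> a" "a \<le> a'" using N ca by auto
    let ?U = "{x\<in>set s. x < c}"
    have "card (\<C> - {N}) < card \<C>" using N less.prems by (intro psubset_card_mono) auto
    moreover have "?U \<subseteq> \<Union>(\<C> - {N})"
    proof
      fix x assume x: "x \<in> ?U"
      then have "x \<in> ?W" using a(1) \<open>c \<le> a\<close> by simp
      then obtain N' where "N' \<in> \<C>" "x \<in> N'" using less.prems(3) by blast
      moreover have "x \<notin> N" using x ca(1) by simp
      ultimately show "x \<in> \<Union>(\<C> - {N})" by blast
    qed
    moreover have "finite (\<C> - {N})" "\<forall>N\<in>\<C> - {N}. monotone_interval N"
      using less.prems(1,2) by auto
    ultimately obtain rs where rs: "length rs \<le> card (\<C> - {N})" "\<forall>r\<in>set rs. is_run r"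
      "distinct (concat rs)" "set (concat rs) = ?U"
      "\<forall>k. k \<in> set s \<and> Suc k \<in> set s \<and> Suc k < c \<longrightarrow> adj k (concat rs) = adj k s"
      using less.hyps[of "\<C> - {N}" c] by blast
    obtain r where r: "is_run r" "distinct r" "set r = {c..a}"
      "\<And>k. c \<le> k \<Longrightarrow> k < a \<Longrightarrow> adj k r = adj k s"
    proof (cases "\<forall>k. c \<le> k \<and> k < a' \<longrightarrow> asc k")
      case True
      then show ?thesis using \<open>c \<le> a\<close> \<open>a \<le> a'\<close> is_run_upt adj_upt
        by (intro that[of "[c..<Suc a]"]) auto
    next
      case False
      have "adj k (rev [c..<Suc a]) = adj k s" if "c \<le> k" "k < a" for k
      proof -
        have "k \<in> set s" "Suc k \<in> set s" using ca that \<open>a \<le> a'\<close> by auto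
        then have "adj k s = [Suc k, k]" using not_asc[of k] ca(3) False that \<open>a \<le> a'\<close> by auto
        then show ?thesis using adj_upt[OF that] by (simp add: adj_rev del: upt_Suc)
      qed
      then show ?thesis using \<open>c \<le> a\<close> is_run_upt
        by (intro that[of "rev [c..<Suc a]"]) (auto simp del: upt_Suc)
    qed
    \<comment> \<open>The only neighbours split between \<open>rs\<close> and \<open>r\<close> are
      \<open>c - 1\<close> and \<open>c\<close>, so \<open>r\<close> goes to the right exactly when
      \<open>c - 1\<close> precedes \<open>c\<close> in \<open>s\<close>.\<close>
    define rs' where "rs' = (if 0 < c \<and> asc (c - 1) then rs @ [r] else r # rs)"
    have "{c..a} \<subseteq> set s" using ca(1,2) \<open>a \<le> a'\<close> by fastforce
    then have W: "?W = ?U \<union> {c..a}" using a \<open>c \<le> a\<close> by (auto simp: not_le[symmetric])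
    have "Suc (card (\<C> - {N})) = card \<C>" using N(1) less.prems(1) by (intro card_Suc_Diff1)
    then have "length rs' \<le> card \<C>" using rs by (simp add: rs'_def)
    moreover have "\<forall>r\<in>set rs'. is_run r" "distinct (concat rs')" "set (concat rs') = ?W"
      using rs r W unfolding rs'_def by (auto simp del: set_concat)
    moreover have "adj k (concat rs') = adj k s" if k: "k \<in> set s" "Suc k \<in> set s" "Suc k < b" for k
    proof -
      have "k < a" using a(2)[of "Suc k"] k by auto
      consider "Suc k < c" | "Suc k = c" | "c \<le> k" by linarith
      then show ?thesis
      proof cases
        case 1
        then have "adj k r = []" using adj_distinct[of r k] r by auto
        then show ?thesis using 1 rs k by (auto simp: rs'_def)
      next
        case 2
        have "adj k r = [Suc k]" using adj_distinct[of r k] r 2 \<open>c \<le> a\<close> by auto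
        moreover have "adj k (concat rs) = [k]"
          using adj_distinct[of "concat rs" k] rs 2 k by (auto simp del: set_concat)
        ultimately show ?thesis using 2 not_asc[of k] k by (auto simp: rs'_def)
      next
        case 3
        then have "adj k (concat rs) = []"
          using adj_distinct[of "concat rs" k] rs k by (auto simp del: set_concat)
        then show ?thesis using r(4)[OF 3 \<open>k < a\<close>] by (auto simp: rs'_def)
      qed
    qed
    ultimately show ?thesis by (intro exI[of _ rs']) blast
  qed
qed

lemma run_num_le_cover:
  assumes "finite \<C>" "\<forall>N\<in>\<C>. monotone_interval N" "set s \<subseteq> \<Union>\<C>"
  shows "run_num n (word_perm s) \<le> card \<C>"
proof -
  have V: "{x\<in>set s. x < n} = set s" using word by (auto simp: is_word_def)
  then obtain rs where rs: "length rs \<le> card \<C>" "\<forall>r\<in>set rs. is_run r" "distinct (concat rs)"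
    "set (concat rs) = set s"
    "\<forall>k. k \<in> set s \<and> Suc k \<in> set s \<and> Suc k < n \<longrightarrow> adj k (concat rs) = adj k s"
    using runs_from_cover[of \<C> n] assms by auto
  have "word_perm (concat rs) = sub (set s)"
    using rs V by (intro sub_word_perm) blast+
  moreover have "reduced n (concat rs)"
    using rs word by (intro distinct_reduced) (auto simp: is_word_def simp del: set_concat)
  ultimately have "run_num n (word_perm s) \<le> length rs"
    unfolding run_num_def using rs sub_all by (intro Least_le) auto
  then show ?thesis using rs by simp
qed

end

section \<open>The partner word\<close>

lemma word_perm_upt:
  "c \<le> d \<Longrightarrow> word_perm [c..<d] x = (if x = d then c else if c \<le> x \<and> x < d then Suc x else x)"
  by (induction c rule: inc_induct) (auto simp: upt_conv_Cons sigma_apply simp del: upt_Suc)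

lemma word_perm_rev_upt:
  "c \<le> d \<Longrightarrow> word_perm (rev [c..<d]) x = (if x = c then d else if c < x \<and> x \<le> d then x - 1 else x)"
  by (induction d rule: dec_induct) (auto simp: sigma_apply)

lemma ascending_upt: "c \<le> d \<Longrightarrow> ascending_word [c..<d]"
proof (induction c rule: inc_induct)
  case (step c)
  have "word_perm [Suc c..<d] c = c" "word_perm [Suc c..<d] d = Suc c"
    using step.hyps by (simp_all add: word_perm_upt)
  then have "\<exists>i j. i < j \<and> word_perm [Suc c..<d] i = c \<and> word_perm [Suc c..<d] j = Suc c"
    using step.hyps by blast
  then show ?case using step by (simp add: upt_conv_Cons del: upt_Suc)
qed simp

lemma ascending_rev_upt: "c \<le> d \<Longrightarrow> ascending_word (rev [c..<d])"
proof (induction d rule: dec_induct)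
  case (step d)
  have "word_perm (rev [c..<d]) c = d" "word_perm (rev [c..<d]) (Suc d) = Suc d"
    using step.hyps by (simp_all add: word_perm_rev_upt)
  then have "\<exists>i j. i < j \<and> word_perm (rev [c..<d]) i = d \<and> word_perm (rev [c..<d]) j = Suc d"
    using step.hyps by (metis le_imp_less_Suc)
  then show ?case using step by simp
qed simp

lemma ascending_increasing_partner:
  assumes "a \<le> b"
  shows "ascending_word ([Suc a..<Suc b] @ [a..<b])"
proof -
  have "ascending_word ([k..<Suc b] @ [a..<b])" if "Suc a \<le> k" "k \<le> Suc b" for k
    using that(2,1)
  proof (induction k rule: inc_induct)
    case base
    then show ?case using assms ascending_upt by simp
  next
    case (step k)
    let ?w = "[Suc k..<Suc b] @ [a..<b]"
    \<comment> \<open>Witnesses \<open>k - 1\<close> and \<open>Suc b\<close>: the second half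
      raises \<open>k - 1\<close> to \<open>k\<close>, and the letters of the first half already
      present lower \<open>Suc b\<close> to \<open>Suc k\<close>.\<close>
    have "word_perm [a..<b] (k - 1) = k" "word_perm [a..<b] (Suc b) = Suc b"
      using step by (auto simp: word_perm_upt)
    then have "word_perm ?w (k - 1) = k" "word_perm ?w (Suc b) = Suc k"
      using step.hyps by (simp_all add: word_perm_upt del: upt_Suc)
    moreover have "k - 1 < Suc b" using step.hyps by simp
    ultimately have "\<exists>i j. i < j \<and> word_perm ?w i = k \<and> word_perm ?w j = Suc k" by blast
    then have "ascending_word (k # ?w)" using step by (simp del: upt_Suc)
    then show ?case using step.hyps by (simp add: upt_conv_Cons del: upt_Suc)
  qed
  from this[of "Suc a"] assms show ?thesis by simp
qed

lemma ascending_decreasing_partner: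
  assumes "a \<le> b"
  shows "ascending_word (rev [a..<b] @ rev [Suc a..<Suc b])"
proof -
  have "ascending_word (rev [a..<m] @ rev [Suc a..<Suc b])" if "a \<le> m" "m \<le> b" for m
    using that
  proof (induction m rule: dec_induct)
    case base
    then show ?case using assms ascending_rev_upt[of "Suc a" "Suc b"] by simp
  next
    case (step m)
    let ?w = "rev [a..<m] @ rev [Suc a..<Suc b]"
    \<comment> \<open>Witnesses \<open>a\<close> and \<open>Suc (Suc m)\<close>: the letters of the
      first half already present raise \<open>a\<close> to \<open>m\<close>, and the second half
      lowers \<open>Suc (Suc m)\<close> to \<open>Suc m\<close>.\<close>
    have "word_perm (rev [Suc a..<Suc b]) a = a"
      "word_perm (rev [Suc a..<Suc b]) (Suc (Suc m)) = Suc m"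
      using step by (auto simp: word_perm_rev_upt simp del: upt_Suc)
    then have "word_perm ?w a = m" "word_perm ?w (Suc (Suc m)) = Suc m"
      using step.hyps by (simp_all add: word_perm_rev_upt del: upt_Suc)
    moreover have "a < Suc (Suc m)" using step.hyps by simp
    ultimately have "\<exists>i j. i < j \<and> word_perm ?w i = m \<and> word_perm ?w j = Suc m" by blast
    then have "ascending_word (m # ?w)" using step by (simp del: upt_Suc)
    moreover have "rev [a..<Suc m] = m # rev [a..<m]" using step.hyps by simp
    ultimately show ?case by (simp del: upt_Suc)
  qed
  from this[of b] assms show ?thesis by simp
qed

text \<open>The witnesses \<open>i < j\<close> for a letter of \<open>u\<close> lie between
  \<open>a\<close> and \<open>Suc b\<close>, so \<open>i\<close> is not a letter of
  \<open>w\<close>. Hence \<open>w\<close> respects the cut after \<open>i\<close>, and the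
  preimages of \<open>i\<close> and \<open>j\<close> keep their order.\<close>

lemma ascending_append:
  assumes "ascending_word u" "ascending_word w" "set u \<subseteq> {a..b}" "set w \<inter> {a..b} = {}"
  shows "ascending_word (u @ w)"
  using assms(1,3)
proof (induction u)
  case (Cons k u)
  then obtain i j where ij: "i < j" "word_perm u i = k" "word_perm u j = Suc k" by auto
  have k: "a \<le> k" "k \<le> b" and u: "set u \<subseteq> {a..b}" using Cons.prems by auto
  have "a \<le> i"
  proof (rule ccontr)
    assume "\<not> a \<le> i"
    then have "0 < a" "i \<le> a - 1" by auto
    then have "a - 1 \<notin> set u" using u by (metis Suc_pred' atLeastAtMost_iff diff_Suc_1 not_less_eq_eq order_refl subsetD)
    then have "word_perm u i \<le> a - 1" using word_perm_le_iff \<open>i \<le> a - 1\<close> by blast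
    then show False using ij k \<open>\<not> a \<le> i\<close> by simp
  qed
  moreover have "Suc b \<notin> set u" using u by auto
  then have "j \<le> Suc b" using word_perm_le_iff[of "Suc b" u j] ij k by simp
  ultimately have "i \<notin> set w" using ij assms(4) by auto
  obtain i' where i': "word_perm w i' = i" using word_perm_surj .
  obtain j' where j': "word_perm w j' = j" using word_perm_surj .
  have "i' \<le> i" "\<not> j' \<le> i"
    using word_perm_le_iff[OF \<open>i \<notin> set w\<close>] i' j' ij(1) by (metis order_refl not_le)+
  then have "i' < j'" by simp
  then have "\<exists>i j. i < j \<and> word_perm (u @ w) i = k \<and> word_perm (u @ w) j = Suc k"
    using i' j' ij by auto
  moreover have "ascending_word (u @ w)" using Cons.IH Cons.prems by auto
  ultimately show ?case by simp
qed (simp add: assms)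

text \<open>Absorbs the single-letter case: for \<open>a = b\<close> both halves of
  \<open>run_t r\<close> are empty.\<close>

lemma is_runE:
  assumes "is_run r"
  obtains (inc) a b where "a \<le> b" "r = [a..<Suc b]" "run_t r = [Suc a..<Suc b] @ [a..<b]"
  | (dec) a b where "a \<le> b" "r = rev [a..<Suc b]" "run_t r = rev [a..<b] @ rev [Suc a..<Suc b]"
proof -
  have len: "length r > 0" and hd: "hd r = r ! 0" using assms by (auto simp: is_run_def hd_conv_nth)
  define l where "l = length r - 1"
  have l: "length r = Suc l" using len by (simp add: l_def)
  consider "\<forall>i<length r. r ! i = hd r + i" | "\<forall>i<length r. r ! i + i = hd r"
    using assms by (auto simp: is_run_def)
  then show thesis
  proof cases
    case 1
    have r: "r = [hd r..<Suc (hd r + l)]"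
      using 1 l by (intro nth_equalityI) (auto simp del: upt_Suc)
    have "run_t r = [Suc (hd r)..<Suc (hd r + l)] @ [hd r..<hd r + l]"
    proof (cases l)
      case (Suc m)
      then have "r ! 1 = Suc (r ! 0)" using 1[rule_format, of 1] l hd by simp
      then show ?thesis using l Suc by (simp add: run_t_def Let_def)
    qed (use l in \<open>simp add: run_t_def\<close>)
    then show ?thesis using inc[of "hd r" "hd r + l"] r by simp
  next
    case 2
    then have a: "r ! l + l = hd r" using l by simp
    have r: "r = rev [r ! l..<Suc (hd r)]"
    proof (intro nth_equalityI)
      show "length r = length (rev [r ! l..<Suc (hd r)])" using a l by simp
      fix i assume i: "i < length r"
      have "rev [r ! l..<Suc (hd r)] ! i = [r ! l..<Suc (hd r)] ! (l - i)"
        using a i l by (subst rev_nth) (auto simp del: upt_Suc)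
      also have "\<dots> = r ! l + (l - i)" using a i l by (intro nth_upt) simp
      finally show "r ! i = rev [r ! l..<Suc (hd r)] ! i"
        using a 2[rule_format, OF i] i l by simp
    qed
    have "run_t r = rev [r ! l..<hd r] @ rev [Suc (r ! l)..<Suc (hd r)]"
    proof (cases l)
      case (Suc m)
      have "r ! 1 + 1 = r ! 0" using 2[rule_format, of 1] l hd Suc by simp
      moreover have "last r = r ! l" using len by (simp add: last_conv_nth l_def)
      moreover have "\<not> length r \<le> 1" "r ! 1 \<noteq> Suc (r ! 0)" "length r - 1 = l"
        using l Suc calculation(1) by simp_all
      ultimately have "run_t r = rev [r ! l..<r ! l + l] @ rev [r ! l + 1..<r ! l + l + 1]"
        unfolding run_t_def Let_def by (simp only: if_False)
      then show ?thesis unfolding a by simp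
    qed (use l a in \<open>simp add: run_t_def\<close>)
    then show ?thesis using dec[of "r ! l" "hd r"] r a by simp
  qed
qed

lemma run_interval:
  assumes "is_run r"
  obtains a b where "a \<le> b" "set r = {a..b}" "ascending_word (run_t r)" "set (run_t r) \<subseteq> {a..b}"
  using assms
proof (cases rule: is_runE)
  case (inc a b)
  then show ?thesis
    using ascending_increasing_partner[of a b] by (intro that[of a b]) auto
next
  case (dec a b)
  then show ?thesis
    using ascending_decreasing_partner[of a b] by (intro that[of a b]) (auto simp del: upt_Suc)
qed

lemma set_run_t: "is_run r \<Longrightarrow> set (run_t r) \<subseteq> set r"
  by (metis run_interval)

lemma set_concat_run_t: "\<forall>r\<in>set rs. is_run r \<Longrightarrow> set (concat (map run_t rs)) \<subseteq> set (concat rs)"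
  using set_run_t by fastforce

lemma ascending_concat_run_t:
  assumes "\<forall>r\<in>set rs. is_run r" "distinct (concat rs)"
  shows "ascending_word (concat (map run_t rs))"
  using assms
proof (induction rs)
  case (Cons r rs)
  obtain a b where r: "set r = {a..b}" "ascending_word (run_t r)" "set (run_t r) \<subseteq> {a..b}"
    using run_interval[of r] Cons.prems(1) by (metis list.set_intros(1))
  have "set (concat rs) \<inter> set r = {}" using Cons.prems(2) by auto
  moreover have "set (concat (map run_t rs)) \<subseteq> set (concat rs)"
    using Cons.prems(1) by (intro set_concat_run_t) simp
  ultimately have "set (concat (map run_t rs)) \<inter> {a..b} = {}" using r(1) by blast
  moreover have "ascending_word (concat (map run_t rs))" using Cons by simp
  ultimately show ?case using ascending_append r(2,3) by simp
qed simp

text \<open>Stated for a general \<open>g\<close> to serve both the partner (\<open>run_t\<close>)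
  and the run word itself (the identity).\<close>

lemma filter_concat_block:
  assumes "distinct (concat rs)" "\<forall>r\<in>set rs. set (g r) \<subseteq> set r" "r \<in> set rs" "r \<noteq> []"
  shows "filter (\<lambda>x. x \<in> set r) (concat (map g rs)) = g r"
  using assms
proof (induction rs)
  case (Cons q rs)
  have sub: "set (concat (map g rs)) \<subseteq> set (concat rs)" using Cons.prems(2) by fastforce
  have disj: "set q \<inter> set (concat rs) = {}" using Cons.prems(1) by simp
  show ?case
  proof (cases "r = q")
    case True
    have "filter (\<lambda>x. x \<in> set q) (concat (map g rs)) = []"
      using sub disj by (auto simp: filter_empty_conv)
    moreover have "filter (\<lambda>x. x \<in> set q) (g q) = g q"
      using Cons.prems(2) by (auto simp: filter_id_conv)
    ultimately show ?thesis using True by simp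
  next
    case False
    then have r: "r \<in> set rs" using Cons.prems by simp
    then have "set r \<inter> set q = {}" using disj by auto
    then have "filter (\<lambda>x. x \<in> set r) (g q) = []"
      using Cons.prems(2) by (auto simp: filter_empty_conv)
    then show ?thesis using Cons.IH Cons.prems r by simp
  qed
qed simp

lemma word_perm_commute:
  assumes "\<forall>x\<in>set A. \<forall>y\<in>set B. Suc x < y"
  shows "word_perm (A @ B) = word_perm (B @ A)"
  using assms
proof (induction B)
  case (Cons k B)
  have "word_perm A \<circ> sigma k = sigma k \<circ> word_perm A" using Cons.prems by (intro sigma_commute) auto
  moreover have "word_perm (A @ B) = word_perm (B @ A)" using Cons.prems by (intro Cons.IH) simp
  then have "word_perm A \<circ> word_perm B = word_perm B \<circ> word_perm A" by (simp only: word_perm_append)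
  ultimately show ?case unfolding word_perm_append word_perm_Cons by (metis comp_assoc)
qed simp

lemma subseq_revI: "subseq u w \<Longrightarrow> subseq (rev u) (rev w)"
  by (induction rule: list_emb.induct) (auto simp: subseq_rev_drop_many intro: list_emb_append_mono)

text \<open>A missing letter \<open>x\<close> splits the run into the letters below and above
  \<open>x\<close>, which commute. In exchanged order, each piece is found in one half of
  \<open>run_t r\<close>.\<close>

lemma proper_subword_of_run:
  assumes "is_run r" "\<not> set r \<subseteq> F"
  obtains u where "subseq u (run_t r)" "word_perm u = word_perm (filter (\<lambda>x. x \<in> F) r)"
proof -
  let ?f = "filter (\<lambda>x. x \<in> F)"
  obtain x where x: "x \<in> set r" "x \<notin> F" using assms(2) by blast
  have split: "[a..<Suc b] = [a..<x] @ x # [Suc x..<Suc b]" if "a \<le> x" "x \<le> b" for a b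
    using that by (metis le_imp_less_Suc le_SucI upt_add_eq_append upt_conv_Cons le_Suc_ex)
  have subA: "subseq (?f [a..<x]) [a..<b]" if "x \<le> b" "a \<le> x" for a b
  proof -
    have "[a..<b] = [a..<x] @ [x..<b]" using that by (metis upt_add_eq_append le_Suc_ex)
    then show ?thesis by (simp add: subseq_rev_drop_many)
  qed
  have subB: "subseq (?f [Suc x..<Suc b]) [Suc a..<Suc b]" if "x \<le> b" "a \<le> x" for a b
  proof -
    have "[Suc a..<Suc b] = [Suc a..<Suc x] @ [Suc x..<Suc b]"
      using that by (metis upt_add_eq_append le_Suc_ex Suc_le_mono)
    then show ?thesis by (simp add: subseq_drop_many del: upt_Suc)
  qed
  have far: "\<forall>y\<in>set (?f [a..<x]). \<forall>z\<in>set (?f [Suc x..<Suc b]). Suc y < z" for a b by auto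
  from assms(1) show thesis
  proof (cases rule: is_runE)
    case (inc a b)
    have ab: "a \<le> x" "x \<le> b" using x(1) inc(2) by auto
    show ?thesis
    proof (rule that)
      show "subseq (?f [Suc x..<Suc b] @ ?f [a..<x]) (run_t r)"
        unfolding inc(3) using subA subB ab by (intro list_emb_append_mono)
      show "word_perm (?f [Suc x..<Suc b] @ ?f [a..<x]) = word_perm (?f r)"
        unfolding inc(2) split[OF ab] using word_perm_commute[OF far] x(2) by simp
    qed
  next
    case (dec a b)
    have ab: "a \<le> x" "x \<le> b" using x(1) dec(2) by auto
    have far': "\<forall>y\<in>set (rev (?f [a..<x])). \<forall>z\<in>set (rev (?f [Suc x..<Suc b])). Suc y < z"
      using far by auto
    have "?f r = rev (?f [a..<x] @ ?f [Suc x..<Suc b])"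
      unfolding dec(2) split[OF ab] using x(2) by (simp add: rev_filter)
    then have r: "?f r = rev (?f [Suc x..<Suc b]) @ rev (?f [a..<x])" by simp
    show ?thesis
    proof (rule that)
      show "subseq (rev (?f [a..<x]) @ rev (?f [Suc x..<Suc b])) (run_t r)"
        unfolding dec(3) using subA subB ab by (intro list_emb_append_mono) (simp_all add: subseq_revI del: upt_Suc)
      show "word_perm (rev (?f [a..<x]) @ rev (?f [Suc x..<Suc b])) = word_perm (?f r)"
        unfolding r by (rule word_perm_commute[OF far'])
    qed
  qed
qed

lemma proper_subword_of_runs:
  assumes "\<forall>r\<in>set rs. is_run r \<and> \<not> set r \<subseteq> F"
  shows "\<exists>u. subseq u (concat (map run_t rs)) \<and>
    word_perm u = word_perm (filter (\<lambda>x. x \<in> F) (concat rs))"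
  using assms
proof (induction rs)
  case (Cons r rs)
  obtain u where u: "subseq u (run_t r)" "word_perm u = word_perm (filter (\<lambda>x. x \<in> F) r)"
    using proper_subword_of_run[of r F] Cons.prems by auto
  obtain u' where u': "subseq u' (concat (map run_t rs))"
    "word_perm u' = word_perm (filter (\<lambda>x. x \<in> F) (concat rs))"
    using Cons by auto
  have "subseq (u @ u') (run_t r @ concat (map run_t rs))" using u(1) u'(1) by (rule list_emb_append_mono)
  then show ?case using u u' by (intro exI[of _ "u @ u'"]) simp
qed auto

text \<open>Moving from \<open>k\<close> to the adjacent letter, no letter of the run can be taken from the
  first half of \<open>run_t r\<close>, while the last one does not occur in the second half.\<close>
lemma run_not_subword:
  assumes "is_run r" "subseq u (run_t r)" "distinct u" "set u = set r"
    and adj: "\<And>k. k \<in> set r \<Longrightarrow> Suc k \<in> set r \<Longrightarrow> adj k u = adj k r"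
  shows False
  using assms(1)
proof (cases rule: is_runE)
  case (inc a b)
  obtain u1 u2 where u: "u = u1 @ u2" "subseq u1 [Suc a..<Suc b]" "subseq u2 [a..<b]"
    using assms(2) unfolding inc(3) by (auto simp: subseq_append_iff)
  have "k \<notin> set u1" if "a \<le> k" "k \<le> b" for k
    using that
  proof (induction k rule: dec_induct)
    case base
    then show ?case using subseq_set[OF u(2)] by auto
  next
    case (step k)
    have "adj k u1 @ adj k u2 = [k, Suc k]"
      using adj[of k] adj_upt[of a k b] step inc u(1) by (auto simp del: upt_Suc)
    moreover have "adj k u1 = (if Suc k \<in> set u1 then [Suc k] else [])"
      using adj_distinct[of u1 k] step assms(3) u(1) by auto
    ultimately show ?case by (auto split: if_splits)
  qed
  then have "b \<notin> set u1" using inc by simp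
  moreover have "b \<notin> set u2" using subseq_set[OF u(3)] by auto
  moreover have "b \<in> set u" using assms(4) inc(1,2) by (simp del: upt_Suc)
  ultimately show False using u(1) by simp
next
  case (dec a b)
  obtain u1 u2 where u: "u = u1 @ u2" "subseq u1 (rev [a..<b])" "subseq u2 (rev [Suc a..<Suc b])"
    using assms(2) unfolding dec(3) by (auto simp: subseq_append_iff)
  have "k \<notin> set u1" if "a \<le> k" "k \<le> b" for k
    using that(2,1)
  proof (induction k rule: inc_induct)
    case base
    then show ?case using subseq_set[OF u(2)] by auto
  next
    case (step k)
    have "adj k u1 @ adj k u2 = [Suc k, k]"
      using adj[of k] adj_upt[of a k b] step dec u(1) by (auto simp: adj_rev simp del: upt_Suc)
    moreover have "k \<in> set u1 \<Longrightarrow> adj k u1 = [k]"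
      using adj_distinct[of u1 k] step assms(3) u(1) by auto
    ultimately show ?case by auto
  qed
  then have "a \<notin> set u1" using dec by simp
  moreover have "a \<notin> set u2" using subseq_set[OF u(3)] by (auto simp del: upt_Suc)
  moreover have "a \<in> set u" using assms(4) dec(1,2) by (simp del: upt_Suc)
  ultimately show False using u(1) by simp
qed

section \<open>The nonfaces of the partner\<close>

locale boolean_runs =
  fixes n :: nat and rs :: "nat list list"
  assumes rword: "is_word n (concat rs)" and rdist: "distinct (concat rs)"
    and runs: "\<forall>r\<in>set rs. is_run r"

sublocale boolean_runs \<subseteq> boolean_word n "concat rs"
  using rword rdist by unfold_locales

context boolean_runs
begin

definition partner :: "nat list" where
  "partner = concat (map run_t rs)"

lemma word_partner: "is_word n partner"
  using set_concat_run_t[OF runs] rword unfolding partner_def is_word_def by blast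

lemma ascending_partner: "ascending_word partner"
  unfolding partner_def using ascending_concat_run_t[OF runs rdist] .

text \<open>A reduced subword representing \<open>sub (set r)\<close> uses only letters of
  \<open>r\<close>, and since the runs are disjoint it lies inside the block \<open>run_t r\<close>;
  \<open>run_not_subword\<close> excludes this.\<close>

lemma run_not_le_partner:
  assumes "r \<in> set rs"
  shows "\<not> bruhat_le n (sub (set r)) (word_perm partner)"
proof
  assume "bruhat_le n (sub (set r)) (word_perm partner)"
  then obtain u0 where u0: "subseq u0 partner" "word_perm u0 = sub (set r)"
    using bruhat_le_subseq by blast
  obtain u where u: "subseq u u0" "ascending_word u" "word_perm u = word_perm u0"
    using reduced_subseq[of u0] .
  have up: "subseq u partner" using u(1) u0(1) by (rule subseq_order.order_trans)
  then have "is_word n u" using word_partner is_word_subseq by blast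
  moreover have rV: "set r \<subseteq> set (concat rs)" using assms by auto
  moreover have "word_perm u = sub (set r)" using u(3) u0(2) by simp
  ultimately have d: "distinct u" "set u = set r"
    "\<And>k. k \<in> set r \<Longrightarrow> Suc k \<in> set r \<Longrightarrow> adj k u = adj k (concat rs)"
    using sub_ascending_word[OF u(2)] by auto
  have run: "is_run r" "r \<noteq> []" using runs assms by (auto simp: is_run_def)
  have "filter (\<lambda>x. x \<in> set r) partner = run_t r"
    unfolding partner_def using rdist assms run runs set_run_t by (intro filter_concat_block) auto
  then have "subseq (filter (\<lambda>x. x \<in> set r) u) (run_t r)" using subseq_filter[OF up] by metis
  moreover have "filter (\<lambda>x. x \<in> set r) u = u" using d(2) by (simp add: filter_id_conv)
  ultimately have "subseq u (run_t r)" by simp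
  moreover have "adj k u = adj k r" if "k \<in> set r" "Suc k \<in> set r" for k
  proof -
    have "filter (\<lambda>x. x \<in> set r) (concat (map (\<lambda>x. x) rs)) = r"
      using rdist assms run by (intro filter_concat_block) auto
    then show ?thesis using d(3)[OF that] adj_filter[OF that, of "concat rs"] by simp
  qed
  ultimately show False using run_not_subword[OF run(1) _ d(1,2)] by blast
qed

lemma faces_partner:
  "faces (word_perm partner) = {F. F \<subseteq> set (concat rs) \<and> (\<forall>r\<in>set rs. \<not> set r \<subseteq> F)}"
proof (intro set_eqI iffI)
  fix F assume F: "F \<in> faces (word_perm partner)"
  have "\<not> set r \<subseteq> F" if "r \<in> set rs" for r
    using faces_down[OF F, of "set r"] run_not_le_partner[OF that] by (auto simp: faces_def)
  then show "F \<in> {F. F \<subseteq> set (concat rs) \<and> (\<forall>r\<in>set rs. \<not> set r \<subseteq> F)}"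
    using F by (auto simp: faces_def)
next
  fix F assume F: "F \<in> {F. F \<subseteq> set (concat rs) \<and> (\<forall>r\<in>set rs. \<not> set r \<subseteq> F)}"
  then obtain u where "subseq u partner" "word_perm u = sub F"
    using proper_subword_of_runs[of rs F] runs unfolding partner_def sub_def by auto
  then have "bruhat_le n (sub F) (word_perm partner)"
    using subseq_bruhat_le[OF ascending_partner word_partner, of u] by simp
  then show "F \<in> faces (word_perm partner)" using F by (simp add: faces_def)
qed

end

section \<open>Almost perfect matchings\<close>

lemma apm_singleton: "apm n {z} z"
  unfolding apm_def
  by (intro exI[of _ "[{z}]"]) (auto simp: coideal_def le_Suc_eq)

lemma coideal_trans: "coideal n Q C \<Longrightarrow> coideal n C U \<Longrightarrow> coideal n Q U"
  unfolding coideal_def by blast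

text \<open>The coideals grow downward from the top, so a new pair is appended to the list of blocks
  and \<open>C\<close> becomes the last coideal before the whole set.\<close>

lemma apm_add_pair:
  assumes "apm n C z" "coideal n (C \<union> {x, y}) C" "x \<notin> C" "y \<notin> C"
    and "bruhat_lt n x y" "len n y = len n x + 1"
  shows "apm n (C \<union> {x, y}) z"
proof -
  obtain Ds i where Ds: "\<Union>(set Ds) = C"
    "\<forall>i<length Ds. \<forall>j<length Ds. i \<noteq> j \<longrightarrow> Ds ! i \<inter> Ds ! j = {}"
    "\<forall>k\<le>length Ds. coideal n C (\<Union>(set (take k Ds)))"
    "i < length Ds" "Ds ! i = {z}"
    "\<forall>j<length Ds. j \<noteq> i \<longrightarrow> (\<exists>x y. Ds ! j = {x, y} \<and> bruhat_lt n x y \<and> len n y = len n x + 1)"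
    using assms(1) unfolding apm_def by (elim exE conjE) rule
  let ?Es = "Ds @ [{x, y}]"
  have new: "Ds ! j \<inter> {x, y} = {}" if "j < length Ds" for j
  proof -
    have "Ds ! j \<subseteq> C" using Ds(1) nth_mem[OF that] by blast
    then show ?thesis using assms(3,4) by blast
  qed
  show ?thesis
    unfolding apm_def
  proof (intro exI[of _ ?Es] conjI exI[of _ i] allI impI)
    show "\<Union>(set ?Es) = C \<union> {x, y}" using Ds(1) by auto
    show "?Es ! k \<inter> ?Es ! j = {}" if "k < length ?Es" "j < length ?Es" "k \<noteq> j" for k j
      using that Ds(2) new[of k] new[of j] by (auto simp: nth_append less_Suc_eq)
    show "coideal n (C \<union> {x, y}) (\<Union>(set (take k ?Es)))" if "k \<le> length ?Es" for k
    proof (cases "k \<le> length Ds")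
      case True
      then have "coideal n C (\<Union>(set (take k Ds)))" using Ds(3) by blast
      then show ?thesis using coideal_trans[OF assms(2)] True by simp
    next
      case False
      then have "\<Union>(set (take k ?Es)) = C \<union> {x, y}" using that Ds(1) by auto
      then show ?thesis by (simp add: coideal_def)
    qed
    show "i < length ?Es" "?Es ! i = {z}" using Ds by (simp_all add: nth_append)
    show "\<exists>x y. ?Es ! j = {x, y} \<and> bruhat_lt n x y \<and> len n y = len n x + 1"
      if "j < length ?Es" "j \<noteq> i" for j
    proof (cases "j < length Ds")
      case True
      then show ?thesis using Ds(6) that by (simp add: nth_append)
    next
      case False
      then have "?Es ! j = {x, y}" using that by (simp add: nth_append)
      then show ?thesis using assms(5,6) by blast
    qed
  qed
qed

section \<open>Matchings by toggling, and the upper bound on the unmatched rank\<close>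

context boolean_word
begin

text \<open>Toggling \<open>x\<close> matches the faces outside \<open>C\<close>; a pair \<open>{G, insert x G}\<close> with \<open>G\<close> of
  maximal size may be added to the coideal \<open>C\<close> first.\<close>
lemma apm_toggle:
  assumes "Q \<subseteq> Pow (set s)" "x \<in> set s" "C \<subseteq> Q"
    and "\<And>F G. F \<in> C \<Longrightarrow> G \<in> Q \<Longrightarrow> F \<subseteq> G \<Longrightarrow> G \<in> C"
    and "\<And>F. F \<in> Q - C \<Longrightarrow> insert x F \<in> Q - C \<and> F - {x} \<in> Q - C"
    and "apm n (sub ` C) z"
  shows "apm n (sub ` Q) z"
  using assms(3-)
proof (induction "card (Q - C)" arbitrary: C rule: less_induct)
  case less
  note C = less.prems
  have finQ: "finite Q" using assms(1) finite_subset by blast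
  show ?case
  proof (cases "Q - C = {}")
    case True
    then have "C = Q" using C(1) by blast
    then show ?thesis using C(4) by simp
  next
    case False
    let ?R = "{F \<in> Q - C. x \<notin> F}"
    obtain F0 where "F0 \<in> Q - C" using False by blast
    then have "F0 - {x} \<in> ?R" using C(3) by blast
    then have R: "card ` ?R \<noteq> {}" "finite (card ` ?R)" using finQ by auto
    then obtain G where G: "G \<in> ?R" "Max (card ` ?R) = card G" using Max_in[OF R(2,1)] by blast
    then have G_max: "card H \<le> card G" if "H \<in> ?R" for H
      using Max_ge[OF R(2), of "card H"] that by simp
    let ?G = "insert x G"
    have GQ: "G \<in> Q - C" "x \<notin> G" "?G \<in> Q - C" using G(1) C(3)[of G] by auto
    then have GV: "G \<subseteq> set s" "?G \<subseteq> set s" using assms(1) by auto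
    then have finG: "finite G" using finite_subset by blast
    let ?C = "C \<union> {G, ?G}"
    have up: "H \<in> ?C" if "F \<in> ?C" "H \<in> Q" "F \<subseteq> H" for F H
    proof (cases "F \<in> C \<or> H \<in> C")
      case True
      then show ?thesis using C(2) that by blast
    next
      case False
      then have GH: "G \<subseteq> H" using that by auto
      have "H - {x} \<in> ?R" using C(3)[of H] False that by auto
      then have "card (H - {x}) \<le> card G" by (rule G_max)
      moreover have "G \<subseteq> H - {x}" using GH GQ(2) by auto
      moreover have "H \<subseteq> set s" using that(2) assms(1) by blast
      then have "finite (H - {x})" using finite_subset by blast
      ultimately have "H - {x} = G" using card_seteq by metis
      then show ?thesis by blast
    qed
    have "apm n (sub ` C \<union> {sub G, sub ?G}) z"
    proof (rule apm_add_pair[OF C(4)])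
      have inj: "sub F = sub H \<longleftrightarrow> F = H" if "F \<in> Q" "H \<in> Q" for F H
        using that assms(1) inj_on_eq_iff[OF inj_sub, of F H] by blast
      have "sub H \<notin> sub ` C" if "H \<in> Q - C" for H
      proof
        assume "sub H \<in> sub ` C"
        then obtain F where "F \<in> C" "sub H = sub F" by blast
        then show False using inj[of H F] that C(1) by blast
      qed
      then show "sub G \<notin> sub ` C" "sub ?G \<notin> sub ` C" using GQ by blast+
      show "bruhat_lt n (sub G) (sub ?G)"
        unfolding bruhat_lt_def using inj[of G ?G] GQ by (auto intro!: sub_mono)
      show "len n (sub ?G) = len n (sub G) + 1" using len_sub GV GQ(2) finG by simp
      show "coideal n (sub ` C \<union> {sub G, sub ?G}) (sub ` C)"
        unfolding coideal_def
      proof (intro conjI ballI impI)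
        fix u y assume u: "u \<in> sub ` C" and y: "y \<in> sub ` C \<union> {sub G, sub ?G}" and le: "bruhat_le n u y"
        obtain F where F: "F \<in> C" "u = sub F" using u by blast
        obtain H where H: "H \<in> Q" "y = sub H" using y C(1) GQ by auto
        have "F \<subseteq> set s" "H \<subseteq> set s" using F H C(1) assms(1) by auto
        then have "F \<subseteq> H" using le F H sub_le_iff by simp
        then show "y \<in> sub ` C" using C(2)[OF F(1) H(1)] H(2) by simp
      qed auto
    qed
    then have "apm n (sub ` ?C) z" by simp
    moreover have "card (Q - ?C) < card (Q - C)"
      using GQ finQ by (intro psubset_card_mono) auto
    moreover have "?C \<subseteq> Q" using C(1) GQ by blast
    moreover have "insert x F \<in> Q - ?C \<and> F - {x} \<in> Q - ?C" if F: "F \<in> Q - ?C" for F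
    proof -
      have "insert x F \<noteq> G" "F - {x} \<noteq> ?G" using GQ(2) by auto
      moreover have "insert x F \<noteq> ?G" using F GQ(2) by (metis DiffE UnCI insert_absorb insert_ident insertCI)
      moreover have "F - {x} \<noteq> G" using F by auto
      ultimately show ?thesis using C(3)[of F] F by auto
    qed
    ultimately show ?thesis using less.hyps[of ?C] up by blast
  qed
qed

text \<open>Complements of coideals are simplicial complexes, so reading the matching from the top
  removes one pair after another by collapses, with \<open>Z\<close> as the single
  exception.\<close>

lemma unmatched_rank_le:
  assumes "w permutes {1..n}" "apm n (sub ` faces w) z"
  shows "len n z + run_num n (word_perm s) \<le> length s"
proof -
  let ?V = "set s"
  obtain Ds p where Ds: "\<Union>(set Ds) = sub ` faces w"
    "\<forall>i<length Ds. \<forall>j<length Ds. i \<noteq> j \<longrightarrow> Ds ! i \<inter> Ds ! j = {}"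
    "\<forall>k\<le>length Ds. coideal n (sub ` faces w) (\<Union>(set (take k Ds)))"
    "p < length Ds" "Ds ! p = {z}"
    "\<forall>j<length Ds. j \<noteq> p \<longrightarrow> (\<exists>x y. Ds ! j = {x, y} \<and> bruhat_lt n x y \<and> len n y = len n x + 1)"
    using assms(2) unfolding apm_def by (elim exE conjE) rule
  define E where "E k = {F \<in> faces w. sub F \<notin> \<Union>(set (take k Ds))}" for k
  have fV: "F \<subseteq> ?V" if "F \<in> faces w" for F using that by (simp add: faces_def)
  have inj: "sub F = sub G \<longleftrightarrow> F = G" if "F \<in> faces w" "G \<in> faces w" for F G
    using fV[OF that(1)] fV[OF that(2)] inj_on_eq_iff[OF inj_sub, of F G] by blast
  have E_Suc: "F \<in> E k \<longleftrightarrow> F \<in> E (Suc k) \<or> F \<in> faces w \<and> sub F \<in> Ds ! k" if k: "k < length Ds" for k F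
  proof -
    have "sub F \<notin> \<Union>(set (take k Ds))" if "sub F \<in> Ds ! k"
    proof
      assume "sub F \<in> \<Union>(set (take k Ds))"
      then obtain j where "j < k" "sub F \<in> Ds ! j" by (auto simp: in_set_conv_nth)
      then show False using Ds(2) k that by (metis disjoint_iff less_irrefl less_trans)
    qed
    then show ?thesis using k by (auto simp: E_def take_Suc_conv_app_nth)
  qed
  have notE: "F \<notin> E (Suc k)" if "k < length Ds" "sub F \<in> Ds ! k" for k F
    using that by (auto simp: E_def take_Suc_conv_app_nth)
  have Ds_sub: "\<exists>F\<in>faces w. x = sub F" if "k < length Ds" "x \<in> Ds ! k" for k x
    using that Ds(1) nth_mem[OF that(1)] by blast
  obtain Z where Z: "Z \<in> faces w" "z = sub Z" using Ds_sub[OF Ds(4)] Ds(5) by blast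
  have "\<not> exact_at ?V (E 0) (Suc (card Z))"
  proof (rule matching_not_exact[where l = "length Ds" and p = p])
    show "finite ?V" by simp
    show "E k \<subseteq> Pow ?V" for k using fV by (auto simp: E_def)
    show "E (length Ds) = {}" using Ds(1) by (auto simp: E_def)
    show "G \<in> E k" if "k \<le> length Ds" "F \<in> E k" "G \<subseteq> F" for k F G
    proof -
      have F: "F \<in> faces w" "G \<in> faces w" "sub F \<notin> \<Union>(set (take k Ds))"
        using that faces_down by (auto simp: E_def)
      have "coideal n (sub ` faces w) (\<Union>(set (take k Ds)))" using Ds(3) that(1) by blast
      then have "sub G \<notin> \<Union>(set (take k Ds))"
        using F sub_mono[OF that(3)] unfolding coideal_def by blast
      then show ?thesis using F(2) by (simp add: E_def)
    qed
    show "p < length Ds" by (rule Ds(4))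
    show "E p = insert Z (E (Suc p))"
      using E_Suc[OF Ds(4)] Ds(5) Z inj by (intro set_eqI) auto
    show "Z \<notin> E (Suc p)" using notE[OF Ds(4)] Ds(5) Z by simp
    show "\<exists>X Y. X \<subseteq> Y \<and> card Y = Suc (card X) \<and> E k = E (Suc k) \<union> {X, Y} \<and>
        X \<notin> E (Suc k) \<and> Y \<notin> E (Suc k)" if k: "k < length Ds" "k \<noteq> p" for k
    proof -
      obtain x y where xy: "Ds ! k = {x, y}" "bruhat_lt n x y" "len n y = len n x + 1"
        using Ds(6) k by blast
      obtain X where X: "X \<in> faces w" "x = sub X" using Ds_sub[OF k(1)] xy(1) by blast
      obtain Y where Y: "Y \<in> faces w" "y = sub Y" using Ds_sub[OF k(1)] xy(1) by blast
      show ?thesis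
      proof (rule exI[of _ X], rule exI[of _ Y], intro conjI)
        show "X \<subseteq> Y" using xy(2) X Y fV sub_le_iff by (simp add: bruhat_lt_def)
        show "card Y = Suc (card X)" using xy(3) X Y fV len_sub by simp
        show "E k = E (Suc k) \<union> {X, Y}"
          using E_Suc[OF k(1)] xy(1) X Y inj by (intro set_eqI) auto
        show "X \<notin> E (Suc k)" "Y \<notin> E (Suc k)" using notE[OF k(1)] xy(1) X Y by simp_all
      qed
    qed
  qed
  then have nex: "\<not> exact_at ?V (faces w) (Suc (card Z))" by (simp add: E_def)
  \<comment> \<open>All nonface intervals are taken, minimal or not; by \<open>faces_eq\<close>,
    avoiding them characterizes the faces.\<close>
  define \<N> where "\<N> = {N. monotone_interval N \<and> N \<notin> faces w}"
  have faces: "F \<in> faces w \<longleftrightarrow> F \<subseteq> ?V \<and> (\<forall>N\<in>\<N>. \<not> N \<subseteq> F)" for F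
    using faces_eq[OF assms(1)] by (auto simp: \<N>_def)
  have "\<N> \<subseteq> Pow ?V" by (auto simp: \<N>_def monotone_interval_def)
  then have finN: "finite \<N>" using finite_subset by blast
  have "card Z + run_num n (word_perm s) \<le> card ?V"
  proof (rule ccontr)
    \<comment> \<open>If the bound fails, a cover by at most \<open>card ?V - card Z\<close> nonface
      intervals would factor the permutation into fewer than \<open>run_num\<close> runs. So there
      is no such cover, and the complex would be exact at the degree of \<open>Z\<close>.\<close>
    assume big: "\<not> ?thesis"
    have "exact_at ?V (faces w) (Suc (card Z))"
    proof (rule exact_atI)
      fix c assume c: "\<And>F. c F \<noteq> 0 \<Longrightarrow> F \<in> faces w \<and> Suc (card F) = Suc (card Z)"
        "\<And>G. G \<subseteq> ?V \<Longrightarrow> bd ?V c G = 0"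
      have "\<exists>e. (\<forall>F. e F \<noteq> 0 \<longrightarrow> {} \<subseteq> F \<and> F \<subseteq> ?V \<and> card F = Suc (card Z) \<and> (\<forall>N\<in>\<N>. \<not> N \<subseteq> F))
        \<and> (\<forall>G. {} \<subseteq> G \<and> G \<subseteq> ?V \<longrightarrow> bd ?V e G = c G)"
      proof (rule cycle_boundary_uncovered)
        show "{} \<subseteq> F \<and> F \<subseteq> ?V \<and> card F = card Z \<and> (\<forall>N\<in>\<N>. \<not> N \<subseteq> F)" if "c F \<noteq> 0" for F
          using c(1)[OF that] faces[of F] by simp
        show "\<not> ?V \<subseteq> {} \<union> \<Union>\<C>" if \<C>: "\<C> \<subseteq> \<N>" "card \<C> + card Z \<le> card ?V" for \<C>
        proof
          assume "?V \<subseteq> {} \<union> \<Union>\<C>"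
          moreover have "finite \<C>" using \<C>(1) finN by (rule finite_subset)
          moreover have "\<forall>N\<in>\<C>. monotone_interval N" using \<C>(1) by (auto simp: \<N>_def)
          ultimately have "run_num n (word_perm s) \<le> card \<C>" by (intro run_num_le_cover) simp_all
          then show False using big \<C>(2) by simp
        qed
      qed (use c(2) finN in simp_all)
      then show "\<exists>e. (\<forall>F. e F \<noteq> 0 \<longrightarrow> F \<in> faces w \<and> card F = Suc (card Z))
          \<and> (\<forall>G. G \<subseteq> ?V \<longrightarrow> bd ?V e G = c G)"
        by (simp add: faces conj_commute conj_left_commute)
    qed
    then show False using nex by simp
  qed
  then show ?thesis using Z len_sub[OF fV[OF Z(1)]] distinct_card[OF dist] by simp
qed

end

section \<open>An almost perfect matching for the partner\<close>

context boolean_runs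
begin

lemma runs_disjoint:
  "r \<in> set rs \<Longrightarrow> r' \<in> set rs \<Longrightarrow> x \<in> set r \<Longrightarrow> x \<in> set r' \<Longrightarrow> r = r'"
  using rdist unfolding distinct_concat_iff by blast

lemma run_nonempty: "r \<in> set rs \<Longrightarrow> r \<noteq> []"
  using runs by (auto simp: is_run_def)

text \<open>One letter of each run is left out, the head by choice. In the join of the simplex
  boundaries this is a face of the largest possible size.\<close>

definition unmatched :: "nat set" where
  "unmatched = set (concat rs) - hd ` set rs"

lemma unmatched_Int:
  assumes "r \<in> set rs"
  shows "set r \<inter> unmatched = set r - {hd r}"
proof -
  have "x = hd r" if "x \<in> set r" "x = hd r'" "r' \<in> set rs" for x r'
    using that assms runs_disjoint[of r r' x] run_nonempty[of r'] by auto
  then show ?thesis using assms by (auto simp: unmatched_def)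
qed

lemma card_unmatched: "card unmatched + length rs = length (concat rs)"
proof -
  have "inj_on hd (set rs)"
    using runs_disjoint run_nonempty by (metis hd_in_set inj_onI)
  then have "card (hd ` set rs) = card (set rs)" by (rule card_image)
  moreover have "distinct rs"
    using rdist run_nonempty unfolding distinct_concat_iff by (metis removeAll_id)
  ultimately have "card (hd ` set rs) = length rs" by (simp add: distinct_card)
  moreover have "hd ` set rs \<subseteq> set (concat rs)" using run_nonempty by auto
  moreover have "card (set (concat rs)) = length (concat rs)" using rdist by (rule distinct_card)
  ultimately show ?thesis
    unfolding unmatched_def using card_Diff_subset[of "hd ` set rs" "set (concat rs)"]
      card_mono[of "set (concat rs)" "hd ` set rs"] by simp
qed

text \<open>The faces on which \<open>hd r\<close> cannot be toggled for any \<open>r\<close> in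
  \<open>qs\<close>: toggling leaves the complex exactly when all of the run except its head is
  present.\<close>

definition partial_faces :: "nat list list \<Rightarrow> nat set set" where
  "partial_faces qs = {F. F \<subseteq> set (concat rs) \<and> (\<forall>r\<in>set rs. \<not> set r \<subseteq> F) \<and>
     (\<forall>r\<in>set qs. set r \<inter> F = set r - {hd r})}"

lemma partial_faces_all: "partial_faces rs = {unmatched}"
proof (intro set_eqI iffI)
  fix F assume "F \<in> partial_faces rs"
  then have F: "F \<subseteq> set (concat rs)" "\<forall>r\<in>set rs. set r \<inter> F = set r \<inter> unmatched"
    using unmatched_Int by (auto simp: partial_faces_def)
  have "x \<in> F \<longleftrightarrow> x \<in> unmatched" if "x \<in> set (concat rs)" for x
    using that F(2) by auto
  then have "F = unmatched" using F(1) unfolding unmatched_def by blast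
  then show "F \<in> {unmatched}" by simp
next
  fix F assume "F \<in> {unmatched}"
  moreover have "\<not> set r \<subseteq> unmatched" if "r \<in> set rs" for r
  proof -
    have "hd r \<in> set r" "hd r \<notin> unmatched" using that run_nonempty[OF that] by (auto simp: unmatched_def)
    then show ?thesis by blast
  qed
  moreover have "unmatched \<subseteq> set (concat rs)" by (auto simp: unmatched_def)
  ultimately show "F \<in> partial_faces rs" using unmatched_Int by (auto simp: partial_faces_def)
qed

text \<open>Releases one run \<open>r\<close> of \<open>qs\<close> at a time. The faces with
  \<open>set r - {hd r}\<close> as trace on \<open>r\<close> form a coideal, because only the full
  run is larger, and all other faces are matched by toggling \<open>hd r\<close>.\<close>

lemma apm_partial_faces:
  assumes "set qs \<subseteq> set rs" "apm n (sub ` partial_faces qs) z"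
  shows "apm n (sub ` partial_faces []) z"
  using assms
proof (induction qs)
  case (Cons r qs)
  have r: "r \<in> set rs" "hd r \<in> set r" using Cons.prems(1) run_nonempty[of r] by auto
  let ?Q = "partial_faces qs"
  let ?C = "partial_faces (r # qs)"
  have C: "F \<in> ?C \<longleftrightarrow> F \<in> ?Q \<and> set r \<inter> F = set r - {hd r}" for F
    by (auto simp: partial_faces_def)
  have "apm n (sub ` ?Q) z"
  proof (rule apm_toggle[where C = ?C and x = "hd r"])
    show "?Q \<subseteq> Pow (set (concat rs))" by (auto simp: partial_faces_def)
    show "hd r \<in> set (concat rs)" using r by auto
    show "?C \<subseteq> ?Q" using C by blast
    show "G \<in> ?C" if "F \<in> ?C" "G \<in> ?Q" "F \<subseteq> G" for F G
    proof -
      have "\<not> set r \<subseteq> G" using that(2) r(1) by (simp add: partial_faces_def)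
      moreover have "set r - {hd r} \<subseteq> G" using that(1,3) C by blast
      ultimately have "set r \<inter> G = set r - {hd r}" by blast
      then show ?thesis using C that(2) by blast
    qed
    show "insert (hd r) F \<in> ?Q - ?C \<and> F - {hd r} \<in> ?Q - ?C" if F: "F \<in> ?Q - ?C" for F
    proof -
      have FQ: "F \<subseteq> set (concat rs)" "\<And>q. q \<in> set rs \<Longrightarrow> \<not> set q \<subseteq> F"
        "\<And>q. q \<in> set qs \<Longrightarrow> set q \<inter> F = set q - {hd q}" and ne: "set r \<inter> F \<noteq> set r - {hd r}"
        using F C by (auto simp: partial_faces_def)
      \<comment> \<open>The trace of \<open>F\<close> on \<open>r\<close> is not the one prescribed
        for runs in \<open>qs\<close>; so \<open>r\<close> is not among them, and toggling
        \<open>hd r\<close> leaves their traces alone.\<close>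
      have "r \<notin> set qs" using FQ(3) ne by blast
      then have out: "hd r \<notin> set q" if "q \<in> set qs" for q
        using that Cons.prems(1) runs_disjoint[of r q "hd r"] r by auto
      have nr: "\<not> set r - {hd r} \<subseteq> F" using FQ(2)[OF r(1)] ne by blast
      have "\<not> set q \<subseteq> insert (hd r) F" if "q \<in> set rs" for q
      proof (cases "q = r")
        case True
        then show ?thesis using nr by blast
      next
        case False
        then have "hd r \<notin> set q" using that runs_disjoint[of r q "hd r"] r by auto
        then show ?thesis using FQ(2)[OF that] by blast
      qed
      moreover have "set q \<inter> insert (hd r) F = set q - {hd q}" "set q \<inter> (F - {hd r}) = set q - {hd q}"
        if "q \<in> set qs" for q
      proof -
        have "set q \<inter> insert (hd r) F = set q \<inter> F" "set q \<inter> (F - {hd r}) = set q \<inter> F"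
          using out[OF that] by auto
        then show "set q \<inter> insert (hd r) F = set q - {hd q}" "set q \<inter> (F - {hd r}) = set q - {hd q}"
          using FQ(3)[OF that] by simp_all
      qed
      moreover have "\<not> set q \<subseteq> F - {hd r}" if "q \<in> set rs" for q
        using FQ(2)[OF that] by blast
      ultimately have inQ: "insert (hd r) F \<in> ?Q" "F - {hd r} \<in> ?Q"
        using FQ(1,2) r by (auto simp: partial_faces_def)
      have "set r \<inter> insert (hd r) F \<noteq> set r - {hd r}" using r(2) by blast
      moreover have "set r \<inter> (F - {hd r}) \<noteq> set r - {hd r}" using nr by blast
      ultimately show ?thesis using inQ C[of "insert (hd r) F"] C[of "F - {hd r}"] by simp
    qed
    show "apm n (sub ` ?C) z" by (rule Cons.prems(2))
  qed
  then show ?case using Cons.IH Cons.prems(1) by simp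
qed

lemma apm_partner: "apm n (sub ` faces (word_perm partner)) (sub unmatched)"
proof -
  have "apm n (sub ` partial_faces rs) (sub unmatched)"
    unfolding partial_faces_all using apm_singleton by simp
  moreover have "partial_faces [] = faces (word_perm partner)"
    unfolding faces_partner by (simp add: partial_faces_def)
  ultimately show ?thesis using apm_partial_faces[of rs] by simp
qed

end

theorem theorem5p14:
  fixes n :: nat and v :: "nat \<Rightarrow> nat" and rs :: "nat list list"
  assumes "boolean_perm n v"
    and "optimal_run_factorization n v rs"
  shows "optimal_partner n v (word_perm (concat (map run_t rs)))
         \<and> ork n v = len n v - run_num n v"
proof -
  have rs: "\<forall>r\<in>set rs. is_run r" "length rs = run_num n v" "reduced n (concat rs)"
    "word_perm (concat rs) = v"
    using assms(2) by (simp_all add: optimal_run_factorization_def)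
  interpret boolean_runs n rs
    using rs assms(1) by unfold_locales (auto simp: boolean_perm_def reduced_def)
  let ?z = "sub unmatched"
  have len: "len n ?z = card unmatched" by (rule len_sub) (auto simp: unmatched_def)
  have lenv: "len n v = length (concat rs)" using rs(3,4) by (simp add: reduced_def)
  have len_z: "len n ?z = len n v - run_num n v" using card_unmatched len lenv rs(2) by simp
  have w: "word_perm partner permutes {1..n}" by (rule word_perm_permutes[OF word_partner])
  have apm: "apm n (bideal n v \<inter> bideal n (word_perm partner)) ?z"
    using apm_partner bideal_Int_eq[of "word_perm partner"] rs(4) by simp
  have upper: "k \<le> len n ?z" if k: "k \<in> ork_set n v" for k
  proof -
    obtain z w where "k = len n z" "w permutes {1..n}" "apm n (bideal n v \<inter> bideal n w) z"
      using k unfolding ork_set_def by blast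
    then have "k + run_num n v \<le> length (concat rs)"
      using unmatched_rank_le[of w z] bideal_Int_eq[of w] rs(4) by simp
    then show ?thesis using len_z lenv by simp
  qed
  have "len n ?z \<in> ork_set n v" unfolding ork_set_def using w apm by blast
  \<comment> \<open>\<open>Max\<close> is only meaningful on a finite set, and the upper bound
    supplies finiteness.\<close>
  moreover have "finite (ork_set n v)" using upper by (meson finite_nat_set_iff_bounded_le)
  ultimately have "ork n v = len n ?z" unfolding ork_def using upper by (intro Max_eqI)
  then show ?thesis using w apm len_z unfolding optimal_partner_def partner_def by auto
qed

end
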